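(* Let $(\pi,\mathcal{L})$ be a submersion between the spray manifolds $(\overline{M},\overline{\mathbf{G}})$ and $(M,\mathbf{G})$. Let $\overline{X}$ be a smooth section of $\mathcal{H}'$, which is defined around $\overline{p}=(x,z,y,l(x,z,y))$ in $\mathcal{L}\backslash0$ and satisfies $\overline{X}(\overline{p})=\Phi^{T(T\overline{M})|_{\mathcal{L}}}_{T\mathcal{L}}\left(a^i\left(\overline{\delta}_{x^i}+\tfrac{\partial}{\partial y^i}l^\alpha(x,z,y)\,\overline{\delta}_{z^\alpha}\right)\right)$. Then we have $$[\overline{\mathbf{G}}|_{\mathcal{L}\backslash0},\overline{X}]|_{\overline{p}}=a^i\mathbf{R}^k_i(x,y)\overline{\partial}_{y^k}\quad\mbox{(mod }\mathcal{H}'\oplus\mathcal{K}'\mbox{)},$$ where $\mathbf{R}^k_i$ are the Riemann curvature coefficients of $(M,\mathbf{G})$.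
   Context: A spray structure on a smooth manifold $M$ is a smooth tangent vector field $\mathbf{G}$ on the slit tangent bundle $TM\backslash 0$ which, in every standard local coordinate $(x^i,y^j)$ (i.e. $x=(x^i)\in M$, $y=y^j\partial_{x^j}\in T_xM$), has the form $\mathbf{G}=y^i\partial_{x^i}-2\mathbf{G}^i\partial_{y^i}$, where $\mathbf{G}^i(x,\lambda y)=\lambda^2\mathbf{G}^i(x,y)$ for all $\lambda>0$. A geodesic is a smooth curve $c(t)$ with nowhere-vanishing $\dot c(t)$ such that $(c(t),\dot c(t))$ is an integral curve of $\mathbf{G}$. Riemann curvature coefficients: $\mathbf{R}^i_k=2\frac{\partial \mathbf{G}^i}{\partial x^k}-y^j\frac{\partial^2\mathbf{G}^i}{\partial x^j\partial y^k}+2\mathbf{G}^j\frac{\partial^2\mathbf{G}^i}{\partial y^j\partial y^k}-\frac{\partial\mathbf{G}^i}{\partial y^j}\frac{\partial\mathbf{G}^j}{\partial y^k}$. Submersion between spray structures: $\pi:\overline{M}^m\to M^n$ is a smooth submersion of manifolds, $\overline{\mathbf{G}}$, $\mathbf{G}$ are spray structures on $\overline{M}$, $M$, and $\mathcal{L}\subset T\overline{M}$ is a distribution (smooth linear subbundle) each of whose fibers $\mathcal{L}_{\overline{q}}$ is a linear complement of $\ker(\pi_*|_{\overline{q}})$ in $T_{\overline{q}}\overline{M}$. The pair $(\pi,\mathcal{L})$ is a submersion between $\overline{\mathbf{G}}$ and $\mathbf{G}$ if (1) $\overline{\mathbf{G}}|_{\mathcal{L}\backslash0}$ is tangent to $\mathcal{L}\backslash0$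 everywhere; (2) for any geodesic $\overline{c}(t)$ of $\overline{\mathbf{G}}$ with $(\overline{c}(t),\dot{\overline{c}}(t))\in\mathcal{L}\backslash0$, $\pi(\overline{c}(t))$ is a geodesic of $\mathbf{G}$. Local coordinates: indices $1\le i,j,k\le n$, $n+1\le\alpha,\beta\le m$, summation convention. Choose local coordinates $(x^i,z^\alpha)$ on $\overline{M}$ and $(x^i)$ on $M$ with $\pi(x,z)=x$; the corresponding standard coordinates are $(x,z,y,w)$ on $T\overline{M}$ (with tangent vector $y^i\overline{\partial}_{x^i}+w^\alpha\overline{\partial}_{z^\alpha}$) and $(x,y)$ on $TM$; bars mark objects on $\overline{M}$ or $T\overline{M}$. Write $\overline{\mathbf{G}}=y^i\overline{\partial}_{x^i}+w^\alpha\overline{\partial}_{z^\alpha}-2\overline{\mathbf{G}}^i\overline{\partial}_{y^i}-2\overline{\mathbf{G}}^\alpha\overline{\partial}_{w^\alpha}$, and let $\overline{\mathbf{N}}^A_j=\partial\overline{\mathbf{G}}^A/\partial y^j$, $\overline{\mathbf{N}}^A_\beta=\partial\overline{\mathbf{G}}^A/\partial w^\beta$ for $A=i$ or $\alpha$. Then $\overline{\delta}_{x^i}=\overline{\partial}_{x^i}-\overline{\mathbf{N}}^j_i\overline{\partial}_{y^j}-\overline{\mathbf{N}}^\beta_i\overline{\partial}_{w^\beta}$, $\overline{\delta}_{z^\alpha}=\overline{\partial}_{z^\alpha}-\overline{\mathbf{N}}^j_\alpha\overline{\partial}_{y^j}-\overline{\mathbf{N}}^\beta_\alpha\overline{\partial}_{w^\beta}$.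 $\mathcal{L}$ is the graph $w^\beta=l^\beta(x,z,y)$ with each $l^\beta$ smooth and homogeneously linear in $y$, so $\partial l^\alpha/\partial y^i$ in fact depends only on $(x,z)$. $\Phi^{T\overline{M}}_{\mathcal{L}}:T\overline{M}\to\mathcal{L}$, $(x,z,y,w)\mapsto(x,z,y,l(x,z,y))$, is the projection along $\ker\pi_*$, and $\Phi^{T(T\overline{M})|_{\mathcal{L}}}_{T\mathcal{L}}$ is the restriction of its tangent map to $T(T\overline{M})|_{\mathcal{L}}$, with values in $T\mathcal{L}$. $\mathcal{H}'$ is the linear subbundle of $T(\mathcal{L}\backslash0)$ whose fiber at $\overline{p}=(x,z,y,l(x,z,y))$ is spanned by $\Phi^{T(T\overline{M})|_{\mathcal{L}}}_{T\mathcal{L}}(\overline{\delta}_{x^i}+\frac{\partial}{\partial y^i}l^\alpha(x,z,y)\,\overline{\delta}_{z^\alpha})$ for all $i$. $\mathcal{K}$ is the linear subbundle of $T(T\overline{M})$ given by the kernel of $(\pi_* )_*:T(T\overline{M})\to T(TM)$, i.e. $\mathcal{K}_{\overline{p}}=\mathrm{span}\{\overline{\partial}_{z^\alpha},\overline{\partial}_{w^\alpha},\forall\alpha\}$. $\mathcal{K}'$ is the linear subbundle of $T(\mathcal{L}\backslash0)$ with fiber $\mathcal{K}'_{\overline{p}}=T_{\overline{p}}(\mathcal{L}\backslash0)\cap\mathcal{K}_{\overline{p}}=\Phi^{T(T\overline{M})|_{\mathcal{L}}}_{T\mathcal{L}}(\mathcal{K}_{\overline{p}})$ at $\overline{p}=(x,z,y,l(x,z,y))$,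 i.e. it is spanned by $\overline{\partial}_{z^\alpha}+\frac{\partial}{\partial z^\alpha}l^\beta(x,z,y)\,\overline{\partial}_{w^\beta}$ for all $\alpha$.
   Formalization: The vector ∂̄_{y^k} on the right is read as its image under Φ, i.e. ∂̄_{y^k} + (∂l^α/∂y^k) ∂̄_{w^α}, which is tangent to L; with the ambient ∂̄_{y^k} the congruence fails in general, as both the bracket and H'⊕K' are tangent to L. *)

theory Defs
  imports "HOL-Analysis.Analysis"
begin

section \<open>Smooth maps between open subsets of Euclidean spaces\<close>

primrec Ck_on :: "nat \<Rightarrow> 'a::real_normed_vector set \<Rightarrow> ('a \<Rightarrow> 'b::real_normed_vector) \<Rightarrow> bool" where
  "Ck_on 0 S f \<longleftrightarrow> continuous_on S f"
| "Ck_on (Suc k) S f \<longleftrightarrow>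
     (\<forall>x\<in>S. f differentiable (at x)) \<and> (\<forall>v. Ck_on k S (\<lambda>x. frechet_derivative f (at x) v))"

text \<open>Only used for open sets \<open>S\<close>.\<close>

definition smooth_on :: "'a::real_normed_vector set \<Rightarrow> ('a \<Rightarrow> 'b::real_normed_vector) \<Rightarrow> bool" where
  "smooth_on S f \<longleftrightarrow> (\<forall>k. Ck_on k S f)"

section \<open>Manifolds, tangent vectors and vector fields\<close>

text \<open>A chart is a pair of its domain and its coordinate map.\<close>

type_synonym ('p, 'e) chart = "'p set \<times> ('p \<Rightarrow> 'e)"

definition chart_inv :: "('p, 'e) chart \<Rightarrow> 'e \<Rightarrow> 'p" where
  "chart_inv c = inv_into (fst c) (snd c)"

definition transition :: "('p, 'e) chart \<Rightarrow> ('p, 'e) chart \<Rightarrow> 'e \<Rightarrow> 'e" where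
  "transition c d = snd d \<circ> chart_inv c"

definition is_chart :: "('p::topological_space, 'e::euclidean_space) chart \<Rightarrow> bool" where
  "is_chart c \<longleftrightarrow> open (fst c) \<and> open (snd c ` fst c) \<and>
     homeomorphism (fst c) (snd c ` fst c) (snd c) (chart_inv c)"

definition compatible :: "('p, 'e::euclidean_space) chart \<Rightarrow> ('p, 'e) chart \<Rightarrow> bool" where
  "compatible c d \<longleftrightarrow>
     smooth_on (snd c ` (fst c \<inter> fst d)) (transition c d) \<and>
     smooth_on (snd d ` (fst c \<inter> fst d)) (transition d c)"

text \<open>The maximal smooth atlas of a manifold whose set of points is the whole type \<open>'p\<close>.\<close>

definition smooth_structure :: "('p::topological_space, 'e::euclidean_space) chart set \<Rightarrow> bool" where
  "smooth_structure A \<longleftrightarrow>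
     (\<forall>c\<in>A. is_chart c) \<and> (\<Union>c\<in>A. fst c) = UNIV \<and> (\<forall>c\<in>A. \<forall>d\<in>A. compatible c d) \<and>
     (\<forall>c. is_chart c \<and> (\<forall>d\<in>A. compatible c d) \<longrightarrow> c \<in> A)"

text \<open>A tangent vector at \<open>p\<close> is the family of its coordinate vectors in all charts around \<open>p\<close>,
  related by the derivatives of the coordinate changes. Outside the charts around \<open>p\<close> the family
  is set to zero, so that equality of tangent vectors is equality of functions.\<close>

type_synonym ('p, 'e) tvec = "('p, 'e) chart \<Rightarrow> 'e"

definition tangent_space :: "('p, 'e::euclidean_space) chart set \<Rightarrow> 'p \<Rightarrow> ('p, 'e) tvec set" where
  "tangent_space A p = {v.
     (\<forall>c\<in>A. \<forall>d\<in>A. p \<in> fst c \<and> p \<in> fst d \<longrightarrow>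
        v d = frechet_derivative (transition c d) (at (snd c p)) (v c)) \<and>
     (\<forall>c. c \<notin> A \<or> p \<notin> fst c \<longrightarrow> v c = 0)}"

abbreviation zero_tvec :: "('p, 'e::euclidean_space) tvec" where
  "zero_tvec \<equiv> (\<lambda>_. 0)"

definition local_rep :: "('p, 'e) chart \<Rightarrow> ('p \<Rightarrow> ('p, 'e) tvec) \<Rightarrow> 'e \<Rightarrow> 'e" where
  "local_rep c X u = X (chart_inv c u) c"

definition vector_field :: "('p, 'e::euclidean_space) chart set \<Rightarrow> ('p \<Rightarrow> ('p, 'e) tvec) \<Rightarrow> bool" where
  "vector_field A X \<longleftrightarrow>
     (\<forall>p\<in>(\<Union>c\<in>A. fst c). X p \<in> tangent_space A p) \<and>
     (\<forall>c\<in>A. smooth_on (snd c ` fst c) (local_rep c X))"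

definition smooth_curve :: "('p, 'e::euclidean_space) chart set \<Rightarrow> real set \<Rightarrow> (real \<Rightarrow> 'p) \<Rightarrow> bool" where
  "smooth_curve A I \<gamma> \<longleftrightarrow> open I \<and> \<gamma> ` I \<subseteq> (\<Union>c\<in>A. fst c) \<and>
     (\<forall>c\<in>A. open {t\<in>I. \<gamma> t \<in> fst c} \<and> smooth_on {t\<in>I. \<gamma> t \<in> fst c} (snd c \<circ> \<gamma>))"

definition velocity :: "('p, 'e::euclidean_space) chart set \<Rightarrow> (real \<Rightarrow> 'p) \<Rightarrow> real \<Rightarrow> ('p, 'e) tvec" where
  "velocity A \<gamma> t =
     (\<lambda>c. if c \<in> A \<and> \<gamma> t \<in> fst c then vector_derivative (snd c \<circ> \<gamma>) (at t) else 0)"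

definition integral_curve ::
  "('p, 'e::euclidean_space) chart set \<Rightarrow> ('p \<Rightarrow> ('p, 'e) tvec) \<Rightarrow> real set \<Rightarrow> (real \<Rightarrow> 'p) \<Rightarrow> bool" where
  "integral_curve A X I \<gamma> \<longleftrightarrow> smooth_curve A I \<gamma> \<and> (\<forall>t\<in>I. velocity A \<gamma> t = X (\<gamma> t))"

text \<open>The tangent space at \<open>q\<close> of an embedded submanifold \<open>S\<close>: velocities of curves inside \<open>S\<close>.\<close>

definition tangent_to ::
  "('p, 'e::euclidean_space) chart set \<Rightarrow> 'p set \<Rightarrow> 'p \<Rightarrow> ('p, 'e) tvec \<Rightarrow> bool" where
  "tangent_to A S q w \<longleftrightarrow> (\<exists>\<gamma>. \<exists>\<epsilon>>0. smooth_curve A {-\<epsilon><..<\<epsilon>} \<gamma> \<and>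
     \<gamma> 0 = q \<and> \<gamma> ` {-\<epsilon><..<\<epsilon>} \<subseteq> S \<and> velocity A \<gamma> 0 = w)"

definition smooth_map ::
  "('p::topological_space, 'e::euclidean_space) chart set \<Rightarrow>
   ('q::topological_space, 'f::euclidean_space) chart set \<Rightarrow> ('p \<Rightarrow> 'q) \<Rightarrow> bool" where
  "smooth_map A B f \<longleftrightarrow> continuous_on UNIV f \<and>
     (\<forall>c\<in>A. \<forall>d\<in>B. smooth_on (snd c ` {p\<in>fst c. f p \<in> fst d}) (snd d \<circ> f \<circ> chart_inv c))"

text \<open>By the chain rule the chart around \<open>p\<close> used for the derivative is immaterial.\<close>

definition tangent_map ::
  "('p, 'e::euclidean_space) chart set \<Rightarrow> ('q, 'f::euclidean_space) chart set \<Rightarrow>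
   ('p \<Rightarrow> 'q) \<Rightarrow> 'p \<Rightarrow> ('p, 'e) tvec \<Rightarrow> ('q, 'f) tvec" where
  "tangent_map A B f p v =
     (let c = (SOME c. c \<in> A \<and> p \<in> fst c) in
      (\<lambda>d. if d \<in> B \<and> f p \<in> fst d
           then frechet_derivative (snd d \<circ> f \<circ> chart_inv c) (at (snd c p)) (v c) else 0))"

definition tangent_kernel ::
  "('p, 'e::euclidean_space) chart set \<Rightarrow> ('q, 'f::euclidean_space) chart set \<Rightarrow>
   ('p \<Rightarrow> 'q) \<Rightarrow> 'p \<Rightarrow> ('p, 'e) tvec set" where
  "tangent_kernel A B f p = {v \<in> tangent_space A p. tangent_map A B f p v = zero_tvec}"

definition smooth_submersion ::
  "('p::topological_space, 'e::euclidean_space) chart set \<Rightarrow>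
   ('q::topological_space, 'f::euclidean_space) chart set \<Rightarrow> ('p \<Rightarrow> 'q) \<Rightarrow> bool" where
  "smooth_submersion A B f \<longleftrightarrow> smooth_map A B f \<and>
     (\<forall>p. tangent_map A B f p ` tangent_space A p = tangent_space B (f p))"

text \<open>A smooth linear subbundle of the tangent bundle, locally spanned by a smooth frame.\<close>

definition distribution ::
  "('p::topological_space, 'e::euclidean_space) chart set \<Rightarrow> ('p \<Rightarrow> ('p, 'e) tvec set) \<Rightarrow> bool" where
  "distribution A L \<longleftrightarrow> (\<forall>p. L p \<subseteq> tangent_space A p) \<and>
     (\<forall>p. \<exists>c\<in>A. \<exists>W r. \<exists>E :: nat \<Rightarrow> 'e \<Rightarrow> 'e. open W \<and> p \<in> W \<and> W \<subseteq> fst c \<and>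
        (\<forall>i<r. smooth_on (snd c ` W) (E i)) \<and>
        (\<forall>q\<in>W. inj_on (\<lambda>i. E i (snd c q)) {..<r} \<and>
               independent ((\<lambda>i. E i (snd c q)) ` {..<r}) \<and>
               (\<lambda>v. v c) ` L q = span ((\<lambda>i. E i (snd c q)) ` {..<r})))"

definition complement_of_kernel ::
  "('p, 'e::euclidean_space) chart set \<Rightarrow> ('q, 'f::euclidean_space) chart set \<Rightarrow>
   ('p \<Rightarrow> 'q) \<Rightarrow> ('p \<Rightarrow> ('p, 'e) tvec set) \<Rightarrow> bool" where
  "complement_of_kernel A B f L \<longleftrightarrow>
     (\<forall>p. \<forall>v\<in>tangent_space A p.
        \<exists>!uk. fst uk \<in> L p \<and> snd uk \<in> tangent_kernel A B f p \<and> v = (\<lambda>c. fst uk c + snd uk c))"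

section \<open>Sprays, geodesics and submersions between spray structures\<close>

text \<open>The slit tangent bundle is again given by charts, the standard charts
  \<open>(p, v) \<mapsto> (x, y)\<close>; so the notions of the previous section apply to it.\<close>

definition slit_chart ::
  "('p, 'e::euclidean_space) chart set \<Rightarrow> ('p, 'e) chart \<Rightarrow>
   ('p \<times> ('p, 'e) tvec, 'e \<times> 'e) chart" where
  "slit_chart A c =
     ({(p, v). p \<in> fst c \<and> v \<in> tangent_space A p \<and> v \<noteq> zero_tvec}, \<lambda>(p, v). (snd c p, v c))"

definition slit_atlas ::
  "('p, 'e::euclidean_space) chart set \<Rightarrow> ('p \<times> ('p, 'e) tvec, 'e \<times> 'e) chart set" where
  "slit_atlas A = slit_chart A ` A"

type_synonym ('p, 'e) bundle_field = "'p \<times> ('p, 'e) tvec \<Rightarrow> ('p \<times> ('p, 'e) tvec, 'e \<times> 'e) tvec"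

text \<open>The coefficients \<open>G\<^sup>i\<close> of \<open>y\<^sup>i \<partial>\<^sub>x\<^sub>i - 2 G\<^sup>i \<partial>\<^sub>y\<^sub>i\<close> in the standard chart of \<open>c\<close>.\<close>

definition spray_coeff ::
  "('p, 'e::euclidean_space) chart set \<Rightarrow> ('p, 'e) bundle_field \<Rightarrow> ('p, 'e) chart \<Rightarrow> 'e \<times> 'e \<Rightarrow> 'e" where
  "spray_coeff A G c u = (- 1 / 2) *\<^sub>R snd (local_rep (slit_chart A c) G u)"

definition spray :: "('p, 'e::euclidean_space) chart set \<Rightarrow> ('p, 'e) bundle_field \<Rightarrow> bool" where
  "spray A G \<longleftrightarrow> vector_field (slit_atlas A) G \<and>
     (\<forall>c\<in>A. \<forall>x\<in>snd c ` fst c. \<forall>y. y \<noteq> 0 \<longrightarrow>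
        fst (local_rep (slit_chart A c) G (x, y)) = y \<and>
        (\<forall>t>0. spray_coeff A G c (x, t *\<^sub>R y) = t\<^sup>2 *\<^sub>R spray_coeff A G c (x, y)))"

definition geodesic ::
  "('p, 'e::euclidean_space) chart set \<Rightarrow> ('p, 'e) bundle_field \<Rightarrow> real set \<Rightarrow> (real \<Rightarrow> 'p) \<Rightarrow> bool" where
  "geodesic A G I c \<longleftrightarrow> open I \<and> connected I \<and> smooth_curve A I c \<and>
     (\<forall>t\<in>I. velocity A c t \<noteq> zero_tvec) \<and>
     integral_curve (slit_atlas A) G I (\<lambda>t. (c t, velocity A c t))"

definition slit_subbundle :: "('p \<Rightarrow> ('p, 'e::euclidean_space) tvec set) \<Rightarrow> ('p \<times> ('p, 'e) tvec) set" where
  "slit_subbundle L = {(p, v). v \<in> L p \<and> v \<noteq> zero_tvec}"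

definition spray_submersion ::
  "('p::topological_space, 'e::euclidean_space) chart set \<Rightarrow> ('p, 'e) bundle_field \<Rightarrow>
   ('q::topological_space, 'f::euclidean_space) chart set \<Rightarrow> ('q, 'f) bundle_field \<Rightarrow>
   ('p \<Rightarrow> 'q) \<Rightarrow> ('p \<Rightarrow> ('p, 'e) tvec set) \<Rightarrow> bool" where
  "spray_submersion Ab Gb A G \<pi> L \<longleftrightarrow>
     smooth_submersion Ab A \<pi> \<and> spray Ab Gb \<and> spray A G \<and>
     distribution Ab L \<and> complement_of_kernel Ab A \<pi> L \<and>
     (\<forall>p\<in>slit_subbundle L. tangent_to (slit_atlas Ab) (slit_subbundle L) p (Gb p)) \<and>
     (\<forall>I c. geodesic Ab Gb I c \<and> (\<forall>t\<in>I. (c t, velocity Ab c t) \<in> slit_subbundle L) \<longrightarrow>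
        geodesic A G I (\<pi> \<circ> c))"

section \<open>Adapted coordinates\<close>

text \<open>Coordinates on the total space are indexed by \<open>'m\<close>, those on the base by \<open>'n\<close>, and an
  injection \<open>\<iota> :: 'n \<Rightarrow> 'm\<close> plays the role of the inclusion of \<open>{1..n}\<close> into \<open>{1..m}\<close>; the vertical
  indices \<open>\<alpha>\<close> are those outside \<open>range \<iota>\<close> (possibly none). A point \<open>(\<xi>, \<eta>)\<close> of the tangent bundle
  of the total space collects \<open>\<xi> = (x, z)\<close> and \<open>\<eta> = (y, w)\<close>, and a point of \<open>L\<close> is given by
  \<open>(\<xi>, y) = (x, z, y)\<close>.\<close>

definition hor :: "('n::finite \<Rightarrow> 'm::finite) \<Rightarrow> real^'m \<Rightarrow> real^'n" where
  "hor \<iota> \<xi> = (\<chi> i. \<xi> $ \<iota> i)"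

definition adapted_charts ::
  "('n::finite \<Rightarrow> 'm::finite) \<Rightarrow> ('p \<Rightarrow> 'q) \<Rightarrow> ('p, real^'m) chart \<Rightarrow> ('q, real^'n) chart \<Rightarrow> bool" where
  "adapted_charts \<iota> \<pi> cb c \<longleftrightarrow>
     (\<forall>p\<in>fst cb. \<pi> p \<in> fst c \<and> snd c (\<pi> p) = hor \<iota> (snd cb p))"

text \<open>\<open>L\<close> is the graph \<open>w\<^sup>\<alpha> = l\<^sup>\<alpha>(x, z, y)\<close> over the chart \<open>cb\<close>.\<close>

definition is_graph_of ::
  "('n::finite \<Rightarrow> 'm::finite) \<Rightarrow> ('p, real^'m) chart set \<Rightarrow> ('p, real^'m) chart \<Rightarrow>
   ('p \<Rightarrow> ('p, real^'m) tvec set) \<Rightarrow> ('m \<Rightarrow> (real^'m) \<times> (real^'n) \<Rightarrow> real) \<Rightarrow> bool" where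
  "is_graph_of \<iota> Ab cb L l \<longleftrightarrow>
     (\<forall>\<alpha>. \<alpha> \<notin> range \<iota> \<longrightarrow>
        smooth_on ((snd cb ` fst cb) \<times> UNIV) (l \<alpha>) \<and>
        (\<forall>\<xi>\<in>snd cb ` fst cb. linear (\<lambda>y. l \<alpha> (\<xi>, y)))) \<and>
     (\<forall>p\<in>fst cb. \<forall>v\<in>tangent_space Ab p.
        v \<in> L p \<longleftrightarrow> (\<forall>\<alpha>. \<alpha> \<notin> range \<iota> \<longrightarrow> v cb $ \<alpha> = l \<alpha> (snd cb p, hor \<iota> (v cb))))"

text \<open>Partial derivatives with respect to the base and the fibre coordinates.\<close>

definition pd_base ::
  "'i::finite \<Rightarrow> ((real^'i) \<times> (real^'j) \<Rightarrow> 'c::real_normed_vector) \<Rightarrow> (real^'i) \<times> (real^'j) \<Rightarrow> 'c" where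
  "pd_base k f u = frechet_derivative f (at u) (axis k 1, 0)"

definition pd_fibre ::
  "'j::finite \<Rightarrow> ((real^'i) \<times> (real^'j) \<Rightarrow> 'c::real_normed_vector) \<Rightarrow> (real^'i) \<times> (real^'j) \<Rightarrow> 'c" where
  "pd_fibre k f u = frechet_derivative f (at u) (0, axis k 1)"

definition riemann_curvature ::
  "((real^'n) \<times> (real^'n) \<Rightarrow> real^'n) \<Rightarrow> 'n::finite \<Rightarrow> 'n \<Rightarrow> (real^'n) \<times> (real^'n) \<Rightarrow> real" where
  "riemann_curvature G i k u =
     2 * pd_base k (\<lambda>u. G u $ i) u
     - (\<Sum>j\<in>UNIV. snd u $ j * pd_base j (pd_fibre k (\<lambda>u. G u $ i)) u)
     + 2 * (\<Sum>j\<in>UNIV. G u $ j * pd_fibre j (pd_fibre k (\<lambda>u. G u $ i)) u)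
     - (\<Sum>j\<in>UNIV. pd_fibre j (\<lambda>u. G u $ i) u * pd_fibre k (\<lambda>u. G u $ j) u)"

text \<open>The field \<open>\<delta>\<^sub>B = \<partial>\<^sub>B - N\<^sup>A\<^sub>B \<partial>\<^sub>\<eta>\<^sub>A\<close> with \<open>N\<^sup>A\<^sub>B = \<partial>G\<^sup>A/\<partial>\<eta>\<^sup>B\<close>; it is \<open>\<delta>\<^sub>x\<^sub>i\<close> for \<open>B = \<iota> i\<close> and
  \<open>\<delta>\<^sub>z\<^sub>\<alpha>\<close> for \<open>B = \<alpha> \<notin> range \<iota>\<close>.\<close>

definition delta_field ::
  "((real^'m) \<times> (real^'m) \<Rightarrow> real^'m) \<Rightarrow> 'm::finite \<Rightarrow> (real^'m) \<times> (real^'m) \<Rightarrow> (real^'m) \<times> (real^'m)" where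
  "delta_field Gb B p =
     (axis B 1, - (\<Sum>A\<in>UNIV. pd_fibre B (\<lambda>u. Gb u $ A) p *\<^sub>R axis A 1))"

definition graph_point ::
  "('n::finite \<Rightarrow> 'm::finite) \<Rightarrow> ('m \<Rightarrow> (real^'m) \<times> (real^'n) \<Rightarrow> real) \<Rightarrow>
   (real^'m) \<times> (real^'n) \<Rightarrow> (real^'m) \<times> (real^'m)" where
  "graph_point \<iota> l u =
     (fst u, \<chi> A. if A \<in> range \<iota> then snd u $ (inv \<iota> A) else l A u)"

text \<open>The projection \<open>(x, z, y, w) \<mapsto> (x, z, y, l(x, z, y))\<close> onto \<open>L\<close>, and its tangent map at the
  point of \<open>L\<close> with coordinates \<open>u = (x, z, y)\<close>.\<close>

definition graph_proj ::
  "('n::finite \<Rightarrow> 'm::finite) \<Rightarrow> ('m \<Rightarrow> (real^'m) \<times> (real^'n) \<Rightarrow> real) \<Rightarrow>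
   (real^'m) \<times> (real^'m) \<Rightarrow> (real^'m) \<times> (real^'m)" where
  "graph_proj \<iota> l p = graph_point \<iota> l (fst p, hor \<iota> (snd p))"

definition graph_proj_tan ::
  "('n::finite \<Rightarrow> 'm::finite) \<Rightarrow> ('m \<Rightarrow> (real^'m) \<times> (real^'n) \<Rightarrow> real) \<Rightarrow>
   (real^'m) \<times> (real^'n) \<Rightarrow> (real^'m) \<times> (real^'m) \<Rightarrow> (real^'m) \<times> (real^'m)" where
  "graph_proj_tan \<iota> l u = frechet_derivative (graph_proj \<iota> l) (at (graph_point \<iota> l u))"

definition hor_lift ::
  "('n::finite \<Rightarrow> 'm::finite) \<Rightarrow> ('m \<Rightarrow> (real^'m) \<times> (real^'n) \<Rightarrow> real) \<Rightarrow>
   ((real^'m) \<times> (real^'m) \<Rightarrow> real^'m) \<Rightarrow> (real^'m) \<times> (real^'n) \<Rightarrow> 'n \<Rightarrow> (real^'m) \<times> (real^'m)" where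
  "hor_lift \<iota> l Gb u i =
     delta_field Gb (\<iota> i) (graph_point \<iota> l u)
     + (\<Sum>\<alpha>\<in>- range \<iota>. pd_fibre i (l \<alpha>) u *\<^sub>R delta_field Gb \<alpha> (graph_point \<iota> l u))"

definition bundle_H' ::
  "('n::finite \<Rightarrow> 'm::finite) \<Rightarrow> ('m \<Rightarrow> (real^'m) \<times> (real^'n) \<Rightarrow> real) \<Rightarrow>
   ((real^'m) \<times> (real^'m) \<Rightarrow> real^'m) \<Rightarrow> (real^'m) \<times> (real^'n) \<Rightarrow> ((real^'m) \<times> (real^'m)) set" where
  "bundle_H' \<iota> l Gb u = span (range (\<lambda>i. graph_proj_tan \<iota> l u (hor_lift \<iota> l Gb u i)))"

text \<open>In adapted coordinates \<open>\<pi>\<^sub>*\<close> is the linear map \<open>(\<xi>, \<eta>) \<mapsto> (hor \<iota> \<xi>, hor \<iota> \<eta>)\<close>, so the kernel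
  of its tangent map does not depend on the point.\<close>

definition bundle_K :: "('n::finite \<Rightarrow> 'm::finite) \<Rightarrow> ((real^'m) \<times> (real^'m)) set" where
  "bundle_K \<iota> = {v. hor \<iota> (fst v) = 0 \<and> hor \<iota> (snd v) = 0}"

definition tangent_L ::
  "('n::finite \<Rightarrow> 'm::finite) \<Rightarrow> ('m \<Rightarrow> (real^'m) \<times> (real^'n) \<Rightarrow> real) \<Rightarrow>
   (real^'m) \<times> (real^'n) \<Rightarrow> ((real^'m) \<times> (real^'m)) set" where
  "tangent_L \<iota> l u = range (frechet_derivative (graph_point \<iota> l) (at u))"

definition bundle_K' ::
  "('n::finite \<Rightarrow> 'm::finite) \<Rightarrow> ('m \<Rightarrow> (real^'m) \<times> (real^'n) \<Rightarrow> real) \<Rightarrow>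
   (real^'m) \<times> (real^'n) \<Rightarrow> ((real^'m) \<times> (real^'m)) set" where
  "bundle_K' \<iota> l u = tangent_L \<iota> l u \<inter> bundle_K \<iota>"

definition lie_bracket ::
  "('e::real_normed_vector \<Rightarrow> 'e) \<Rightarrow> ('e \<Rightarrow> 'e) \<Rightarrow> 'e \<Rightarrow> 'e" where
  "lie_bracket X Y u = frechet_derivative Y (at u) (X u) - frechet_derivative X (at u) (Y u)"

text \<open>Vector fields on \<open>L\<close> are written as functions of the coordinates \<open>(x, z, y)\<close> of \<open>L\<close> with
  values in the components with respect to \<open>\<partial>\<^sub>x, \<partial>\<^sub>z, \<partial>\<^sub>y, \<partial>\<^sub>w\<close>. For a vector tangent to \<open>L\<close>,
  forgetting the \<open>\<partial>\<^sub>w\<close> components gives its components in the chart \<open>(x, z, y)\<close> of \<open>L\<close>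
  (this is inverse to the derivative of \<open>graph_point\<close>). The bracket on \<open>L\<close> is computed in that
  chart and mapped back.\<close>

definition L_components ::
  "('n::finite \<Rightarrow> 'm::finite) \<Rightarrow> (real^'m) \<times> (real^'m) \<Rightarrow> (real^'m) \<times> (real^'n)" where
  "L_components \<iota> v = (fst v, hor \<iota> (snd v))"

definition bracket_on_L ::
  "('n::finite \<Rightarrow> 'm::finite) \<Rightarrow> ('m \<Rightarrow> (real^'m) \<times> (real^'n) \<Rightarrow> real) \<Rightarrow>
   ((real^'m) \<times> (real^'n) \<Rightarrow> (real^'m) \<times> (real^'m)) \<Rightarrow>
   ((real^'m) \<times> (real^'n) \<Rightarrow> (real^'m) \<times> (real^'m)) \<Rightarrow>
   (real^'m) \<times> (real^'n) \<Rightarrow> (real^'m) \<times> (real^'m)" where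
  "bracket_on_L \<iota> l V X u =
     frechet_derivative (graph_point \<iota> l) (at u)
       (lie_bracket (\<lambda>u. L_components \<iota> (V u)) (\<lambda>u. L_components \<iota> (X u)) u)"

text \<open>The coordinate field \<open>\<partial>\<^sub>y\<^sub>k\<close> of the chart \<open>(x, z, y)\<close> of \<open>L\<close>. As a vector of the ambient
  tangent bundle it is the image under the tangent map of the projection onto \<open>L\<close> of the ambient
  \<open>\<partial>\<^sub>y\<^sub>k\<close>, i.e. \<open>\<partial>\<^sub>y\<^sub>k + (\<partial>l\<^sup>\<alpha>/\<partial>y\<^sup>k) \<partial>\<^sub>w\<^sub>\<alpha>\<close>. The ambient \<open>\<partial>\<^sub>y\<^sub>k\<close> itself is in general not tangent
  to \<open>L\<close>, whereas the bracket on \<open>L\<close> and the fibres of \<open>H'\<close> and \<open>K'\<close> are.\<close>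

definition dy_on_L ::
  "('n::finite \<Rightarrow> 'm::finite) \<Rightarrow> ('m \<Rightarrow> (real^'m) \<times> (real^'n) \<Rightarrow> real) \<Rightarrow>
   (real^'m) \<times> (real^'n) \<Rightarrow> 'n \<Rightarrow> (real^'m) \<times> (real^'m)" where
  "dy_on_L \<iota> l u k = graph_proj_tan \<iota> l u (0, axis (\<iota> k) 1)"

end

theory Submission
  imports Defs
begin

text \<open>
  Everything is computed in the coordinates \<open>u = (\<xi>, y)\<close> of \<open>L\<close>, where \<open>\<xi> = (x, z)\<close>; write \<open>horlift (\<xi>, y)\<close> for
  the vector \<open>(y, l(\<xi>, y))\<close> of \<open>L\<close> over \<open>y\<close>. The proof rests on two facts about the restriction of the
  upper spray to \<open>L\<close>.

  Since the spray is tangent to \<open>L\<close>, it equals the image of its own \<open>(\<xi>, y)\<close>-components under the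
  derivative of the graph parametrization (\<open>V_tangent\<close>). Integral curves in these coordinates
  therefore are geodesics with velocity in \<open>L\<close>. Such curves exist and are smooth
  (\<open>ode_local_solution\<close>, \<open>ode_solution_smooth\<close>), and they project to geodesics of the base; comparing
  accelerations, the \<open>x\<close>-components of the upper spray coefficients at a point of \<open>L\<close> are the spray
  coefficients \<open>G\<close> of the base at the projected point (\<open>hor_spray_coeff\<close>).

  Hence in the coordinates \<open>(\<xi>, y)\<close> the spray is \<open>S = (horlift (\<xi>, y), -2G(x, y))\<close>. Differentiating the
  identity of the coefficients in the directions of \<open>L\<close>, the fibre of \<open>H'\<close> becomes the set of all
  \<open>(horlift (\<xi>, b), -N b)\<close> with \<open>N b = DG(x, y)(0, b)\<close> (\<open>L_components_hor_lift\<close>, \<open>bundle_H'_eq\<close>), and the fibre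
  of \<open>K'\<close> the set of all \<open>(\<zeta>, 0)\<close> with \<open>\<zeta>\<close> vertical. A section of \<open>H'\<close> is \<open>Y = (horlift (\<xi>, b), -N b)\<close> for a
  coefficient \<open>b\<close> that depends on the point. If \<open>\<beta>\<close> is the derivative of \<open>b\<close> along \<open>S\<close>, the bracket \<open>[S, Y]\<close>
  has an \<open>x\<close>-component \<open>cc = \<beta> + N b\<close> and a \<open>y\<close>-component
  \<open>- N \<beta> - (D\<^sub>S N) b + 2 (DG(b, 0) - N (N b))\<close>. Removing the element \<open>(horlift (\<xi>, cc), -N cc)\<close> of \<open>H'\<close>
  and a vertical remainder in \<open>K'\<close> leaves the \<open>y\<close>-component
  \<open>2 DG(b, 0) - (D\<^sub>S N) b - N (N b)\<close>, which is the Riemann curvature of the base applied to \<open>b\<close>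
  (\<open>riemann_curvature_contract\<close>, \<open>bracket_mod_H'_K'\<close>).
\<close>

section \<open>Calculus of smooth maps\<close>

lemma has_derivative_frechet:
  "f differentiable (at x) \<Longrightarrow> (f has_derivative frechet_derivative f (at x)) (at x)"
  by (simp add: frechet_derivative_works)

lemma frechet_derivative_eqI:
  "(f has_derivative f') (at x) \<Longrightarrow> frechet_derivative f (at x) = f'"
  by (rule frechet_derivative_at[symmetric])

lemma Ck_on_cong:
  assumes "open S" and "Ck_on k S f" and "\<And>x. x \<in> S \<Longrightarrow> f x = g x"
  shows "Ck_on k S g"
  using assms(2,3)
proof (induction k arbitrary: f g)
  case 0
  then show ?case by (simp cong: continuous_on_cong)
next
  case (Suc k)
  have d: "(g has_derivative frechet_derivative f (at x)) (at x)" if "x \<in> S" for x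
    using Suc.prems that assms(1)
    by (auto intro!: has_derivative_transform_within_open[OF has_derivative_frechet])
  have "frechet_derivative f (at x) v = frechet_derivative g (at x) v" if "x \<in> S" for x v
    using frechet_derivative_eqI[OF d[OF that]] by simp
  then have "Ck_on k S (\<lambda>x. frechet_derivative g (at x) v)" for v
    by (rule Suc.IH[of "\<lambda>x. frechet_derivative f (at x) v", rotated]) (use Suc.prems(1) in auto)
  with d show ?case by (auto simp: differentiable_def)
qed

text \<open>Lets a derivative that was found by a calculus rule replace \<^const>\<open>frechet_derivative\<close> in the
  recursive definition of \<^const>\<open>Ck_on\<close>, which the product and chain rules need.\<close>

lemma Ck_on_Suc_iff:
  assumes "open S" and d: "\<And>x. x \<in> S \<Longrightarrow> (f has_derivative f' x) (at x)"
  shows "Ck_on (Suc k) S f \<longleftrightarrow> (\<forall>v. Ck_on k S (\<lambda>x. f' x v))"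
proof -
  have e: "frechet_derivative f (at x) v = f' x v" if "x \<in> S" for x v
    using d[OF that] by (simp add: frechet_derivative_eqI)
  have "Ck_on k S (\<lambda>x. frechet_derivative f (at x) v) \<longleftrightarrow> Ck_on k S (\<lambda>x. f' x v)" for v
    using Ck_on_cong[OF assms(1)] e by (metis (no_types, lifting))
  then show ?thesis using d by (auto simp: differentiable_def)
qed

lemma Ck_on_subset: "Ck_on k S f \<Longrightarrow> T \<subseteq> S \<Longrightarrow> Ck_on k T f"
  by (induction k arbitrary: f) (auto intro: continuous_on_subset)

lemma Ck_on_Suc_imp_Ck_on: "Ck_on (Suc k) S f \<Longrightarrow> Ck_on k S f"
proof (induction k arbitrary: f)
  case 0
  then show ?case
    by (auto simp: continuous_on_eq_continuous_within
        intro!: differentiable_imp_continuous_within intro: differentiable_at_withinI)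
next
  case (Suc k)
  note D = Suc.prems[unfolded Ck_on.simps(2)[of "Suc k"]]
  have 1: "\<forall>x\<in>S. f differentiable (at x)" using D by (rule conjunct1)
  have 2: "\<forall>v. Ck_on (Suc k) S (\<lambda>x. frechet_derivative f (at x) v)" using D by (rule conjunct2)
  have "\<forall>v. Ck_on k S (\<lambda>x. frechet_derivative f (at x) v)"
    by (rule allI, rule Suc.IH, rule 2[rule_format])
  with 1 show ?case by simp
qed

lemma Ck_on_const: "open S \<Longrightarrow> Ck_on k S (\<lambda>x. c)"
  by (induction k arbitrary: c) auto

lemma Ck_on_bounded_linear_compose:
  assumes "open S" "bounded_linear L" and "Ck_on k S f"
  shows "Ck_on k S (\<lambda>x. L (f x))"
  using assms(3)
proof (induction k arbitrary: f)
  case 0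
  then show ?case using assms(2) by (simp add: bounded_linear.continuous_on)
next
  case (Suc k)
  have d: "((\<lambda>x. L (f x)) has_derivative (\<lambda>v. L (frechet_derivative f (at x) v))) (at x)"
    if "x \<in> S" for x
    using Suc.prems that assms(2)
    by (auto intro!: bounded_linear.has_derivative[OF assms(2)] has_derivative_frechet)
  from Suc.prems show ?case
    by (subst Ck_on_Suc_iff[OF assms(1) d]) (auto intro!: Suc.IH)
qed

lemma Ck_on_bounded_linear:
  assumes "open S" "bounded_linear L"
  shows "Ck_on k S L"
proof (cases k)
  case 0
  then show ?thesis using assms by (simp add: linear_continuous_on)
next
  case (Suc k)
  have "(L has_derivative L) (at x)" if "x \<in> S" for x
    using assms(2) by (rule bounded_linear_imp_has_derivative)
  from Ck_on_Suc_iff[OF assms(1) this] Ck_on_const[OF assms(1)]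
  show ?thesis unfolding Suc by blast
qed

lemma Ck_on_add:
  assumes "open S" "Ck_on k S f" "Ck_on k S g"
  shows "Ck_on k S (\<lambda>x. f x + g x)"
  using assms(2,3)
proof (induction k arbitrary: f g)
  case 0
  then show ?case by (simp add: continuous_on_add)
next
  case (Suc k)
  have d: "((\<lambda>x. f x + g x) has_derivative
      (\<lambda>v. frechet_derivative f (at x) v + frechet_derivative g (at x) v)) (at x)" if "x \<in> S" for x
    using Suc.prems that by (auto intro!: has_derivative_add has_derivative_frechet)
  from Suc.prems show ?case
    by (subst Ck_on_Suc_iff[OF assms(1) d]) (auto intro!: Suc.IH)
qed

lemma Ck_on_sum:
  assumes "open S" "\<And>i. i \<in> I \<Longrightarrow> Ck_on k S (f i)"
  shows "Ck_on k S (\<lambda>x. \<Sum>i\<in>I. f i x)"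
proof (cases "finite I")
  case True
  then show ?thesis using assms(2)
    by (induction I) (auto simp: assms(1) Ck_on_const Ck_on_add)
qed (simp add: assms(1) Ck_on_const)

lemma Ck_on_scaleR:
  assumes "open S" "Ck_on k S f" "Ck_on k S g"
  shows "Ck_on k S (\<lambda>x. f x *\<^sub>R g x)"
  using assms(2,3)
proof (induction k arbitrary: f g)
  case 0
  then show ?case by (simp add: continuous_on_scaleR)
next
  case (Suc k)
  have d: "((\<lambda>x. f x *\<^sub>R g x) has_derivative
      (\<lambda>v. f x *\<^sub>R frechet_derivative g (at x) v + frechet_derivative f (at x) v *\<^sub>R g x)) (at x)"
    if "x \<in> S" for x
    using Suc.prems that by (auto intro!: has_derivative_scaleR has_derivative_frechet)
  have "Ck_on k S f" "Ck_on k S g"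
    using Suc.prems by (auto intro: Ck_on_Suc_imp_Ck_on simp del: Ck_on.simps)
  with Suc.prems show ?case
    by (subst Ck_on_Suc_iff[OF assms(1) d]) (auto intro!: Ck_on_add assms(1) Suc.IH)
qed

text \<open>The regularity of \<open>f\<close> is only available direction by direction, so the derivative of \<open>f\<close> in the
  moving direction \<open>Dg x v\<close> is expanded over a basis; this turns the chain rule into a sum of products
  of functions of class \<open>C\<^sup>k\<close>.\<close>

lemma Ck_on_compose:
  fixes g :: "'a::real_normed_vector \<Rightarrow> 'b::euclidean_space" and f :: "'b \<Rightarrow> 'c::real_normed_vector"
  assumes "open S" "Ck_on k S g" "Ck_on k T f" "g ` S \<subseteq> T"
  shows "Ck_on k S (\<lambda>x. f (g x))"
  using assms(2,3)
proof (induction k arbitrary: f)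
  case 0
  then show ?case using assms(4) by (auto intro: continuous_on_compose2)
next
  case (Suc k)
  let ?D = "\<lambda>x v. \<Sum>b\<in>Basis. (frechet_derivative g (at x) v \<bullet> b) *\<^sub>R frechet_derivative f (at (g x)) b"
  have d: "((\<lambda>x. f (g x)) has_derivative ?D x) (at x)" if "x \<in> S" for x
  proof -
    have g: "g differentiable (at x)" and f: "f differentiable (at (g x))"
      using Suc.prems that assms(4) by auto
    have "linear (frechet_derivative f (at (g x)))" using f by (rule linear_frechet_derivative)
    then have "frechet_derivative f (at (g x)) w
        = (\<Sum>b\<in>Basis. (w \<bullet> b) *\<^sub>R frechet_derivative f (at (g x)) b)" for w
      by (subst euclidean_representation[of w, symmetric]) (simp only: linear_sum linear_cmul)
    with has_derivative_compose[OF has_derivative_frechet[OF g] has_derivative_frechet[OF f]]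
    show ?thesis by (metis (no_types, lifting) ext)
  qed
  have "Ck_on k S g" using Suc.prems(1) by (rule Ck_on_Suc_imp_Ck_on)
  moreover have "Ck_on k S (\<lambda>x. frechet_derivative g (at x) v \<bullet> b)" for v b
    using Suc.prems(1)
    by (intro Ck_on_bounded_linear_compose[OF assms(1) bounded_linear_inner_left]) auto
  moreover have "Ck_on k S (\<lambda>x. frechet_derivative f (at (g x)) b)" for b
    by (rule Suc.IH[of "\<lambda>y. frechet_derivative f (at y) b"]) (use Suc.prems \<open>Ck_on k S g\<close> in auto)
  ultimately show ?case
    by (subst Ck_on_Suc_iff[OF assms(1) d]) (auto intro!: Ck_on_sum Ck_on_scaleR assms(1))
qed

lemma smooth_on_cong:
  "open S \<Longrightarrow> smooth_on S f \<Longrightarrow> (\<And>x. x \<in> S \<Longrightarrow> f x = g x) \<Longrightarrow> smooth_on S g"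
  unfolding smooth_on_def using Ck_on_cong by blast

lemma smooth_on_subset: "smooth_on S f \<Longrightarrow> T \<subseteq> S \<Longrightarrow> smooth_on T f"
  unfolding smooth_on_def using Ck_on_subset by blast

lemma smooth_on_imp_differentiable: "smooth_on S f \<Longrightarrow> x \<in> S \<Longrightarrow> f differentiable (at x)"
  unfolding smooth_on_def by (metis Ck_on.simps(2))

lemma smooth_on_imp_continuous_on: "smooth_on S f \<Longrightarrow> continuous_on S f"
  unfolding smooth_on_def by (metis Ck_on.simps(1))

lemma smooth_on_frechet_derivative:
  "smooth_on S f \<Longrightarrow> smooth_on S (\<lambda>x. frechet_derivative f (at x) v)"
  unfolding smooth_on_def by (metis Ck_on.simps(2))

lemma smooth_on_const: "open S \<Longrightarrow> smooth_on S (\<lambda>x. c)"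
  by (simp add: smooth_on_def Ck_on_const)

lemma smooth_on_bounded_linear: "open S \<Longrightarrow> bounded_linear L \<Longrightarrow> smooth_on S L"
  by (simp add: smooth_on_def Ck_on_bounded_linear)

lemma smooth_on_bounded_linear_compose:
  "open S \<Longrightarrow> bounded_linear L \<Longrightarrow> smooth_on S f \<Longrightarrow> smooth_on S (\<lambda>x. L (f x))"
  by (simp add: smooth_on_def Ck_on_bounded_linear_compose)

lemma smooth_on_add:
  "open S \<Longrightarrow> smooth_on S f \<Longrightarrow> smooth_on S g \<Longrightarrow> smooth_on S (\<lambda>x. f x + g x)"
  by (simp add: smooth_on_def Ck_on_add)

lemma smooth_on_sum:
  "open S \<Longrightarrow> (\<And>i. i \<in> I \<Longrightarrow> smooth_on S (f i)) \<Longrightarrow> smooth_on S (\<lambda>x. \<Sum>i\<in>I. f i x)"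
  by (simp add: smooth_on_def Ck_on_sum)

lemma smooth_on_scaleR:
  "open S \<Longrightarrow> smooth_on S f \<Longrightarrow> smooth_on S g \<Longrightarrow> smooth_on S (\<lambda>x. f x *\<^sub>R g x)"
  by (simp add: smooth_on_def Ck_on_scaleR)

lemma smooth_on_compose:
  fixes g :: "'a::real_normed_vector \<Rightarrow> 'b::euclidean_space"
  shows "open S \<Longrightarrow> smooth_on S g \<Longrightarrow> smooth_on T f \<Longrightarrow> g ` S \<subseteq> T \<Longrightarrow> smooth_on S (\<lambda>x. f (g x))"
  unfolding smooth_on_def by (blast intro: Ck_on_compose)

lemma smooth_on_Pair:
  assumes "open S" "smooth_on S f" "smooth_on S g"
  shows "smooth_on S (\<lambda>x. (f x, g x))"
proof -
  have "bounded_linear (\<lambda>v. (v, 0))" "bounded_linear (\<lambda>v. (0, v))"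
    by (auto intro!: bounded_linear_Pair bounded_linear_ident bounded_linear_zero)
  from smooth_on_bounded_linear_compose[OF assms(1) this(1) assms(2)]
    smooth_on_bounded_linear_compose[OF assms(1) this(2) assms(3)]
  show ?thesis using smooth_on_add[OF assms(1)] by fastforce
qed

section \<open>Local solutions of autonomous differential equations\<close>

lemma Ck_on_locally_lipschitz:
  fixes F :: "'a::euclidean_space \<Rightarrow> 'b::real_normed_vector"
  assumes "Ck_on 1 S F" "cball x r \<subseteq> S"
  obtains K where "K-lipschitz_on (cball x r) F"
proof -
  have "\<exists>B. \<forall>u\<in>cball x r. norm (frechet_derivative F (at u) b) \<le> B" for b
  proof -
    have "continuous_on (cball x r) (\<lambda>u. frechet_derivative F (at u) b)"
      using assms by (auto intro: continuous_on_subset)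
    then have "bounded ((\<lambda>u. frechet_derivative F (at u) b) ` cball x r)"
      by (intro compact_imp_bounded compact_continuous_image) auto
    then show ?thesis by (auto simp: bounded_iff)
  qed
  then obtain B where B: "\<And>b u. u \<in> cball x r \<Longrightarrow> norm (frechet_derivative F (at u) b) \<le> B b"
    by metis
  have d: "(F has_derivative frechet_derivative F (at u)) (at u)" if "u \<in> cball x r" for u
    using assms that by (auto intro!: has_derivative_frechet)
  have o: "onorm (frechet_derivative F (at u)) \<le> (\<Sum>b\<in>Basis. B b)" if "u \<in> cball x r" for u
    using onorm_componentwise[OF has_derivative_bounded_linear[OF d[OF that]]]
    by (rule order_trans) (intro sum_mono B that)
  have le: "(\<Sum>b\<in>Basis. B b) \<le> (\<Sum>b\<in>Basis. \<bar>B b\<bar>)" by (intro sum_mono) simp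
  have "(\<Sum>b\<in>Basis. \<bar>B b\<bar>)-lipschitz_on (cball x r) F"
  proof (rule lipschitz_onI)
    fix u v assume uv: "u \<in> cball x r" "v \<in> cball x r"
    have "norm (F u - F v) \<le> (\<Sum>b\<in>Basis. \<bar>B b\<bar>) * norm (u - v)"
      by (rule differentiable_bound[of "cball x r" F "\<lambda>u. frechet_derivative F (at u)"])
        (use uv d in \<open>auto intro: has_derivative_at_withinI order_trans[OF o le]\<close>)
    then show "dist (F u) (F v) \<le> (\<Sum>b\<in>Basis. \<bar>B b\<bar>) * dist u v" by (simp add: dist_norm)
  qed (simp add: sum_nonneg)
  then show ?thesis using that by blast
qed

text \<open>Picard iteration. On bounded continuous functions on the whole line, with the time frozen outside
  \<open>[-e, e]\<close>, the integral operator is a contraction. The integral from \<open>0\<close> to \<open>t\<close> is written as a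
  difference of two integrals from \<open>-e\<close>, so that both signs of \<open>t\<close> are treated at once; bounding the
  two terms separately costs the factor 3.\<close>

lemma integral_equation_solution:
  fixes F :: "'a::euclidean_space \<Rightarrow> 'a"
  assumes lip: "K-lipschitz_on UNIV F" and bd: "\<And>x. norm (F x) \<le> B"
    and e: "0 < e" "3 * e * K < 1"
  obtains u where "continuous_on UNIV u"
    "\<And>t. t \<in> {-e..e} \<Longrightarrow>
      u t = x + (integral {-e..t} (\<lambda>s. F (u s)) - integral {-e..0} (\<lambda>s. F (u s)))"
proof -
  define cl where "cl t = max (-e) (min e t)" for t :: real
  have cl: "cl t \<in> {-e..e}" "t \<in> {-e..e} \<Longrightarrow> cl t = t" for t
    using e by (auto simp: cl_def)
  have contF: "continuous_on UNIV F" using lip by (rule lipschitz_on_continuous_on)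
  have K0: "0 \<le> K" using lip by (rule lipschitz_on_nonneg)
  have B0: "0 \<le> B" using bd[of x] norm_ge_zero order_trans by blast
  define T :: "(real \<Rightarrow>\<^sub>C 'a) \<Rightarrow> real \<Rightarrow> 'a" where
    "T u t = x + (integral {-e..cl t} (\<lambda>s. F (u s)) - integral {-e..0} (\<lambda>s. F (u s)))" for u t
  have contFu: "continuous_on S (\<lambda>s. F (apply_bcontfun u s))" for S and u :: "real \<Rightarrow>\<^sub>C 'a"
    by (rule continuous_on_compose2[OF contF]) auto
  have ib: "norm (integral {-e..t} g) \<le> C * (2 * e)"
    if "continuous_on UNIV g" "\<And>s. norm (g s) \<le> C" "t \<in> {-e..e}" for t C and g :: "real \<Rightarrow> 'a"
  proof -
    have "norm (integral {-e..t} g) \<le> C * (t - (-e))"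
      using that by (intro integral_bound) (auto intro: continuous_on_subset)
    also have "\<dots> \<le> C * (2 * e)"
      using that(2)[of 0] that(3) norm_ge_zero[of "g 0"] by (intro mult_left_mono) (auto simp del: norm_ge_zero)
    finally show ?thesis .
  qed
  have ib0: "norm (integral {-e..0} g) \<le> C * e"
    if "continuous_on UNIV g" "\<And>s. norm (g s) \<le> C" for C and g :: "real \<Rightarrow> 'a"
    using that e integral_bound[of "-e" 0 g C] by (auto intro: continuous_on_subset)
  have "T u \<in> bcontfun" for u
  proof (rule bcontfun_normI)
    have "continuous_on {-e..e} (\<lambda>t. integral {-e..t} (\<lambda>s. F (u s)))"
      by (intro indefinite_integral_continuous_1 integrable_continuous_real contFu)
    then have "continuous_on UNIV (\<lambda>t. integral {-e..cl t} (\<lambda>s. F (u s)))"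
      by (rule continuous_on_compose2) (use cl(1) in \<open>auto simp: cl_def intro!: continuous_intros\<close>)
    then show "continuous_on UNIV (T u)"
      unfolding T_def by (intro continuous_intros)
    show "norm (T u t) \<le> norm x + (B * (2 * e) + B * e)" for t
    proof -
      have "norm (integral {-e..cl t} (\<lambda>s. F (u s))) \<le> B * (2 * e)"
        by (rule ib[OF contFu bd cl(1)])
      moreover have "norm (integral {-e..0} (\<lambda>s. F (u s))) \<le> B * e"
        by (rule ib0[OF contFu bd])
      ultimately show ?thesis
        unfolding T_def by (smt (verit) norm_triangle_ineq norm_triangle_ineq4)
    qed
  qed
  then have "\<exists>v. apply_bcontfun v = T u" for u by (metis bcontfunE)
  then obtain \<Phi> where \<Phi>: "\<And>u. apply_bcontfun (\<Phi> u) = T u" by metis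
  have "dist (\<Phi> u) (\<Phi> v) \<le> (3 * e * K) * dist u v" for u v
  proof (rule dist_bound)
    fix t
    let ?g = "\<lambda>s. F (u s) - F (v s)"
    have c: "continuous_on UNIV ?g" by (intro continuous_intros contFu)
    have b: "norm (?g s) \<le> K * dist u v" for s
      using lipschitz_onD[OF lip, of "u s" "v s"] dist_bounded[of u s v] K0
      by (simp add: dist_norm) (meson mult_left_mono order_trans)
    have i: "(\<lambda>s. F (apply_bcontfun w s)) integrable_on {a..b}" for w :: "real \<Rightarrow>\<^sub>C 'a" and a b
      by (intro integrable_continuous_real contFu)
    have "T u t - T v t = integral {-e..cl t} ?g - integral {-e..0} ?g"
      unfolding T_def by (simp add: integral_diff i)
    moreover have "norm (integral {-e..cl t} ?g) \<le> (K * dist u v) * (2 * e)"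
      by (rule ib[OF c b cl(1)])
    moreover have "norm (integral {-e..0} ?g) \<le> (K * dist u v) * e"
      by (rule ib0[OF c b])
    ultimately have "norm (T u t - T v t) \<le> (K * dist u v) * (2 * e) + (K * dist u v) * e"
      by (smt (verit) norm_triangle_ineq4)
    then show "dist (\<Phi> u t) (\<Phi> v t) \<le> (3 * e * K) * dist u v"
      by (simp add: \<Phi> dist_norm algebra_simps)
  qed
  then have "\<exists>!u. \<Phi> u = u" using e K0 by (intro banach_fix_type) auto
  then obtain u where "\<Phi> u = u" by blast
  then have fp: "u t = T u t" for t by (metis \<Phi>)
  show ?thesis
  proof (rule that[of u])
    fix t :: real assume "t \<in> {-e..e}"
    then show "u t = x + (integral {-e..t} (\<lambda>s. F (u s)) - integral {-e..0} (\<lambda>s. F (u s)))"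
      using fp[of t] cl(2)[of t] by (simp only: T_def)
  qed simp
qed

text \<open>Composing \<open>F\<close> with the nearest point map of a closed ball makes it globally Lipschitz and bounded.
  For short times the solution of the modified equation stays in the ball, where nothing was
  changed.\<close>

theorem ode_local_solution:
  fixes F :: "'a::euclidean_space \<Rightarrow> 'a"
  assumes "open S" "Ck_on 1 S F" "x \<in> S"
  obtains e u where "0 < e" "u 0 = x"
    "\<And>t. t \<in> {-e<..<e} \<Longrightarrow> u t \<in> S \<and> (u has_vector_derivative F (u t)) (at t)"
proof -
  obtain r where r: "r > 0" "cball x r \<subseteq> S" using assms by (meson open_contains_cball)
  obtain K where K: "K-lipschitz_on (cball x r) F"
    using Ck_on_locally_lipschitz[OF assms(2) r(2)] .
  let ?P = "closest_point (cball x r)"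
  have ne: "cball x r \<noteq> {}" using r by auto
  have P: "?P y \<in> cball x r" "y \<in> cball x r \<Longrightarrow> ?P y = y" for y
    using closest_point_in_set[of "cball x r" y] ne closest_point_self[of y "cball x r"] by auto
  have lip: "K-lipschitz_on UNIV (\<lambda>y. F (?P y))"
  proof (rule lipschitz_onI)
    fix y z
    have "dist (F (?P y)) (F (?P z)) \<le> K * dist (?P y) (?P z)"
      using lipschitz_onD[OF K P(1) P(1)] .
    also have "\<dots> \<le> K * dist y z"
      using closest_point_lipschitz[of "cball x r" y z] ne lipschitz_on_nonneg[OF K]
      by (intro mult_left_mono) auto
    finally show "dist (F (?P y)) (F (?P z)) \<le> K * dist y z" .
  qed (rule lipschitz_on_nonneg[OF K])
  have "bounded (F ` cball x r)"
    using K by (intro compact_imp_bounded compact_continuous_image) (auto intro: lipschitz_on_continuous_on)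
  then obtain B where B: "B > 0" "\<And>y. norm (F (?P y)) \<le> B"
    using P(1) by (auto simp: bounded_pos)
  have K0: "K \<ge> 0" using K by (rule lipschitz_on_nonneg)
  define e where "e = min (r / (3 * B)) (1 / (3 * (K + 1)))"
  have "e * (3 * B) \<le> r / (3 * B) * (3 * B)"
    using B by (intro mult_right_mono) (auto simp: e_def)
  then have e1: "3 * e * B \<le> r" using B by (simp add: algebra_simps)
  have e0: "0 < e" using r B K0 by (auto simp: e_def)
  have "e * (3 * (K + 1)) \<le> 1 / (3 * (K + 1)) * (3 * (K + 1))"
    using K0 by (intro mult_right_mono) (auto simp: e_def)
  then have e2: "3 * e * K < 1" using K0 e0 by (simp add: algebra_simps)
  obtain u where uc: "continuous_on UNIV u" and u: "\<And>t. t \<in> {-e..e} \<Longrightarrow>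
      u t = x + (integral {-e..t} (\<lambda>s. F (?P (u s))) - integral {-e..0} (\<lambda>s. F (?P (u s))))"
    using integral_equation_solution[OF lip B(2) e0 e2, of x] by blast
  let ?g = "\<lambda>s. F (?P (u s))"
  have gc: "continuous_on A ?g" for A
    by (rule continuous_on_compose2[OF lipschitz_on_continuous_on[OF lip]])
      (auto intro: continuous_on_subset[OF uc])
  have ur: "u t \<in> cball x r" if "t \<in> {-e..e}" for t
  proof -
    have 1: "norm (integral {-e..t} ?g) \<le> B * (t - (-e))"
      using that gc B by (intro integral_bound) auto
    have "B * (t + e) \<le> B * (2 * e)" using B that by (intro mult_left_mono) auto
    then have 1: "norm (integral {-e..t} ?g) \<le> B * (2 * e)" using 1 by simp
    have 2: "norm (integral {-e..0} ?g) \<le> B * (0 - (-e))"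
      using e0 gc B by (intro integral_bound) auto
    have "norm (u t - x) \<le> B * (2 * e) + B * e"
      using 1 2 norm_triangle_ineq4[of "integral {-e..t} ?g" "integral {-e..0} ?g"] u[OF that]
      by auto
    also have "\<dots> \<le> r" using e1 by (simp add: algebra_simps)
    finally show ?thesis by (simp add: dist_norm norm_minus_commute)
  qed
  show ?thesis
  proof (rule that[OF e0, of u])
    show "u 0 = x" using u[of 0] e0 by simp
    fix t assume t: "t \<in> {-e<..<e}"
    have "((\<lambda>t. integral {-e..t} ?g) has_vector_derivative ?g t) (at t within {-e..e})"
      using t by (intro integral_has_vector_derivative gc) auto
    then have "((\<lambda>t. x + (integral {-e..t} ?g - integral {-e..0} ?g)) has_vector_derivative ?g t)
        (at t within {-e..e})"
      by (auto intro!: derivative_eq_intros)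
    then have "((\<lambda>t. x + (integral {-e..t} ?g - integral {-e..0} ?g)) has_vector_derivative ?g t)
        (at t)"
      using t by (simp add: at_within_interior[of t "{-e..e}"])
    then have "(u has_vector_derivative ?g t) (at t)"
      by (rule has_vector_derivative_transform_within_open[OF _ _ t]) (auto simp: u)
    moreover have "?g t = F (u t)" using P(2) ur[of t] t by simp
    ultimately show "u t \<in> S \<and> (u has_vector_derivative F (u t)) (at t)"
      using ur[of t] t r by auto
  qed
qed

text \<open>Bootstrapping: a solution of class \<open>C\<^sup>k\<close> has a velocity \<open>F(u(t))\<close> of class \<open>C\<^sup>k\<close>.\<close>

lemma ode_solution_smooth:
  fixes u :: "real \<Rightarrow> 'a::euclidean_space"
  assumes "open I" and F: "smooth_on S F"
    and u: "\<And>t. t \<in> I \<Longrightarrow> u t \<in> S \<and> (u has_vector_derivative F (u t)) (at t)"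
  shows "smooth_on I u"
proof -
  have d: "(u has_derivative (\<lambda>h. h *\<^sub>R F (u t))) (at t)" if "t \<in> I" for t
    using u[OF that] by (simp add: has_vector_derivative_def)
  have "Ck_on k I u" for k
  proof (induction k)
    case 0
    have "isCont u t" if "t \<in> I" for t
      using u[OF that] has_vector_derivative_continuous by blast
    then show ?case by (simp add: continuous_at_imp_continuous_on)
  next
    case (Suc k)
    then have "Ck_on k I (\<lambda>t. F (u t))"
      using F u by (intro Ck_on_compose[OF assms(1) Suc]) (auto simp: smooth_on_def)
    then show ?case
      by (subst Ck_on_Suc_iff[OF assms(1) d])
        (auto intro: Ck_on_bounded_linear_compose[OF assms(1) bounded_linear_scaleR_right])
  qed
  then show ?thesis by (simp add: smooth_on_def)
qed

section \<open>Charts, velocities and geodesics\<close>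

text \<open>What is shared by the maximal atlas of a manifold and the atlas of its slit tangent bundle, which
  is not maximal. Only images of charts are required to be open, so no topology on the points of the
  tangent bundle enters.\<close>

definition smooth_atlas :: "('p, 'e::euclidean_space) chart set \<Rightarrow> bool" where
  "smooth_atlas A \<longleftrightarrow> (\<forall>c\<in>A. inj_on (snd c) (fst c)) \<and>
     (\<forall>c\<in>A. \<forall>d\<in>A. open (snd c ` (fst c \<inter> fst d)) \<and>
        smooth_on (snd c ` (fst c \<inter> fst d)) (transition c d))"

lemma smooth_atlasD:
  assumes "smooth_atlas A" "c \<in> A" "d \<in> A"
  shows "inj_on (snd c) (fst c)" "open (snd c ` (fst c \<inter> fst d))"
    "smooth_on (snd c ` (fst c \<inter> fst d)) (transition c d)"
  using assms by (auto simp: smooth_atlas_def)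

lemma smooth_atlas_open_image: "smooth_atlas A \<Longrightarrow> c \<in> A \<Longrightarrow> open (snd c ` fst c)"
  using smooth_atlasD(2)[of A c c] by simp

lemma chart_inv_coord: "smooth_atlas A \<Longrightarrow> c \<in> A \<Longrightarrow> p \<in> fst c \<Longrightarrow> chart_inv c (snd c p) = p"
  unfolding chart_inv_def by (rule inv_into_f_f) (rule smooth_atlasD(1))

lemma chart_inv_image:
  "x \<in> snd c ` fst c \<Longrightarrow> chart_inv c x \<in> fst c"
  "x \<in> snd c ` fst c \<Longrightarrow> snd c (chart_inv c x) = x"
  unfolding chart_inv_def by (auto intro: inv_into_into f_inv_into_f)

lemma transition_coord:
  "smooth_atlas A \<Longrightarrow> c \<in> A \<Longrightarrow> p \<in> fst c \<Longrightarrow> transition c d (snd c p) = snd d p"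
  by (simp add: transition_def chart_inv_coord)

lemma transition_has_derivative:
  assumes "smooth_atlas A" "c \<in> A" "d \<in> A" "p \<in> fst c" "p \<in> fst d"
  shows "(transition c d has_derivative frechet_derivative (transition c d) (at (snd c p))) (at (snd c p))"
  using smooth_on_imp_differentiable[OF smooth_atlasD(3)[OF assms(1-3)]] assms
  by (intro has_derivative_frechet) auto

lemma smooth_structure_imp_smooth_atlas:
  assumes "smooth_structure A"
  shows "smooth_atlas A"
proof -
  have ch: "is_chart c" if "c \<in> A" for c
    using assms that by (simp add: smooth_structure_def)
  have inj: "inj_on (snd c) (fst c)" if "c \<in> A" for c
    using ch[OF that] by (auto simp: is_chart_def homeomorphism_def intro!: inj_on_inverseI)
  have "open (snd c ` (fst c \<inter> fst d))" if "c \<in> A" "d \<in> A" for c d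
  proof -
    have c: "open (snd c ` fst c)" "continuous_on (snd c ` fst c) (chart_inv c)"
      and inv: "\<And>p. p \<in> fst c \<Longrightarrow> chart_inv c (snd c p) = p"
      using ch[OF that(1)] by (auto simp: is_chart_def homeomorphism_def)
    have d: "open (fst d)" using ch[OF that(2)] by (simp add: is_chart_def)
    have "snd c ` (fst c \<inter> fst d) = snd c ` fst c \<inter> chart_inv c -` fst d"
      using inv by (auto simp: image_iff)
    then show ?thesis using continuous_open_preimage[OF c(2) c(1) d] by simp
  qed
  with inj assms show ?thesis
    unfolding smooth_atlas_def smooth_structure_def compatible_def by blast
qed

lemma transition_chain:
  assumes A: "smooth_atlas A" and "c \<in> A" "d \<in> A" "e \<in> A"
    and p: "p \<in> fst c" "p \<in> fst d" "p \<in> fst e"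
  shows "frechet_derivative (transition c e) (at (snd c p)) v
    = frechet_derivative (transition d e) (at (snd d p))
        (frechet_derivative (transition c d) (at (snd c p)) v)"
proof -
  let ?N = "snd c ` (fst c \<inter> fst d)"
  have "((\<lambda>x. transition d e (transition c d x)) has_derivative
      (\<lambda>v. frechet_derivative (transition d e) (at (snd d p))
        (frechet_derivative (transition c d) (at (snd c p)) v))) (at (snd c p))"
    using transition_has_derivative[OF A \<open>d \<in> A\<close> \<open>e \<in> A\<close> p(2,3)]
    by (intro has_derivative_compose[OF transition_has_derivative[OF A]])
      (simp_all add: assms transition_coord[OF A])
  then have "(transition c e has_derivative
      (\<lambda>v. frechet_derivative (transition d e) (at (snd d p))
        (frechet_derivative (transition c d) (at (snd c p)) v))) (at (snd c p))"
    by (rule has_derivative_transform_within_open[where s = ?N])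
      (use assms smooth_atlasD(2)[OF A] in \<open>auto simp: transition_coord[OF A]\<close>)
  then show ?thesis by (simp add: frechet_derivative_eqI)
qed

lemma transition_self:
  assumes A: "smooth_atlas A" and "c \<in> A" "p \<in> fst c"
  shows "frechet_derivative (transition c c) (at (snd c p)) = (\<lambda>v. v)"
proof -
  have "(transition c c has_derivative (\<lambda>v. v)) (at (snd c p))"
    by (rule has_derivative_transform_within_open[OF has_derivative_ident, where s = "snd c ` fst c"])
      (use assms smooth_atlas_open_image[OF A] in \<open>auto simp: transition_coord[OF A]\<close>)
  then show ?thesis by (rule frechet_derivative_eqI)
qed

text \<open>The tangent vector with prescribed coordinates in one chart.\<close>

definition tvec_of :: "('p, 'e::euclidean_space) chart set \<Rightarrow> ('p, 'e) chart \<Rightarrow> 'p \<Rightarrow> 'e \<Rightarrow> ('p, 'e) tvec" where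
  "tvec_of A c p v =
     (\<lambda>d. if d \<in> A \<and> p \<in> fst d then frechet_derivative (transition c d) (at (snd c p)) v else 0)"

lemma tvec_of:
  assumes A: "smooth_atlas A" and "c \<in> A" "p \<in> fst c"
  shows "tvec_of A c p v \<in> tangent_space A p" "tvec_of A c p v c = v"
proof -
  have "tvec_of A c p v e = frechet_derivative (transition d e) (at (snd d p)) (tvec_of A c p v d)"
    if "d \<in> A" "e \<in> A" "p \<in> fst d" "p \<in> fst e" for d e
    using transition_chain[OF A \<open>c \<in> A\<close> that(1,2) \<open>p \<in> fst c\<close> that(3,4), of v] that
    by (simp only: tvec_of_def simp_thms if_True)
  moreover have "tvec_of A c p v d = 0" if "d \<notin> A \<or> p \<notin> fst d" for d
    using that by (auto simp: tvec_of_def)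
  ultimately show "tvec_of A c p v \<in> tangent_space A p"
    unfolding tangent_space_def by blast
  show "tvec_of A c p v c = v"
    using assms transition_self[OF assms] by (simp add: tvec_of_def)
qed

lemma tangent_space_coord:
  "v \<in> tangent_space A p \<Longrightarrow> c \<in> A \<Longrightarrow> d \<in> A \<Longrightarrow> p \<in> fst c \<Longrightarrow> p \<in> fst d \<Longrightarrow>
     v d = frechet_derivative (transition c d) (at (snd c p)) (v c)"
  unfolding tangent_space_def by blast

lemma tangent_space_outside:
  "v \<in> tangent_space A p \<Longrightarrow> c \<notin> A \<or> p \<notin> fst c \<Longrightarrow> v c = 0"
  unfolding tangent_space_def by blast

lemma tangent_space_eqI:
  assumes "v \<in> tangent_space A p" "w \<in> tangent_space A p" "c \<in> A" "p \<in> fst c" "v c = w c"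
  shows "v = w"
proof
  fix d show "v d = w d"
  proof (cases "d \<in> A \<and> p \<in> fst d")
    case True
    then have d: "d \<in> A" "p \<in> fst d" by auto
    show ?thesis
      unfolding tangent_space_coord[OF assms(1,3) d(1) assms(4) d(2)]
        tangent_space_coord[OF assms(2,3) d(1) assms(4) d(2)] assms(5) ..
  next
    case False
    then have "v d = 0" "w d = 0"
      using tangent_space_outside[OF assms(1)] tangent_space_outside[OF assms(2)] by blast+
    then show ?thesis by simp
  qed
qed

lemma tangent_space_zero_iff:
  assumes A: "smooth_atlas A" and v: "v \<in> tangent_space A p" and c: "c \<in> A" "p \<in> fst c"
  shows "v = zero_tvec \<longleftrightarrow> v c = 0"
proof
  assume v0: "v c = 0"
  show "v = zero_tvec"
  proof
    fix d show "v d = 0"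
    proof (cases "d \<in> A \<and> p \<in> fst d")
      case True
      then have d: "d \<in> A" "p \<in> fst d" by auto
      have "linear (frechet_derivative (transition c d) (at (snd c p)))"
        by (rule has_derivative_linear[OF transition_has_derivative[OF A c(1) d(1) c(2) d(2)]])
      then show ?thesis
        unfolding tangent_space_coord[OF v c(1) d(1) c(2) d(2)] v0 by (rule linear_0)
    next
      case False
      then show ?thesis using tangent_space_outside[OF v] by blast
    qed
  qed
qed simp

lemma slit_chart_simps:
  "(p, v) \<in> fst (slit_chart A c) \<longleftrightarrow> p \<in> fst c \<and> v \<in> tangent_space A p \<and> v \<noteq> zero_tvec"
  "snd (slit_chart A c) (p, v) = (snd c p, v c)"
  by (simp_all add: slit_chart_def)

lemma slit_chart_image_Int:
  fixes A :: "('p, 'e::euclidean_space) chart set"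
  assumes A: "smooth_atlas A" and c: "c \<in> A"
  shows "snd (slit_chart A c) ` (fst (slit_chart A c) \<inter> fst (slit_chart A d))
     = (snd c ` (fst c \<inter> fst d)) \<times> (- {0})"
proof (intro equalityI subsetI)
  fix u assume "u \<in> snd (slit_chart A c) ` (fst (slit_chart A c) \<inter> fst (slit_chart A d))"
  then obtain p v where u: "u = (snd c p, v c)" and pv: "p \<in> fst c" "p \<in> fst d"
      "v \<in> tangent_space A p" "v \<noteq> zero_tvec"
    by (auto simp: slit_chart_def)
  then show "u \<in> (snd c ` (fst c \<inter> fst d)) \<times> (- {0})"
    using tangent_space_zero_iff[OF A pv(3) c pv(1)] by auto
next
  fix u :: "'e \<times> 'e" assume "u \<in> (snd c ` (fst c \<inter> fst d)) \<times> (- {0})"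
  then obtain p y where u: "u = (snd c p, y)" "p \<in> fst c" "p \<in> fst d" "y \<noteq> 0" by auto
  have t: "tvec_of A c p y \<in> tangent_space A p" "tvec_of A c p y c = y"
    using tvec_of[OF A c u(2)] by auto
  then have "(p, tvec_of A c p y) \<in> fst (slit_chart A c) \<inter> fst (slit_chart A d)"
    using u by (auto simp: slit_chart_simps)
  moreover have "u = snd (slit_chart A c) (p, tvec_of A c p y)"
    by (simp add: slit_chart_simps u t)
  ultimately show "u \<in> snd (slit_chart A c) ` (fst (slit_chart A c) \<inter> fst (slit_chart A d))"
    by blast
qed

lemma slit_chart_image:
  assumes "smooth_atlas A" "c \<in> A"
  shows "snd (slit_chart A c) ` fst (slit_chart A c) = (snd c ` fst c) \<times> (- {0})"
  using slit_chart_image_Int[OF assms, of c] by simp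

lemma smooth_on_tangent_map:
  fixes \<tau> :: "'a::euclidean_space \<Rightarrow> 'b::euclidean_space"
  assumes "open U" "open T" "smooth_on U \<tau>"
  shows "smooth_on (U \<times> T) (\<lambda>u. (\<tau> (fst u), frechet_derivative \<tau> (at (fst u)) (snd u)))"
proof -
  have o: "open (U \<times> T)" using assms by (simp add: open_Times)
  have fst: "smooth_on (U \<times> T) (fst :: 'a \<times> 'a \<Rightarrow> 'a)"
    by (intro smooth_on_bounded_linear o bounded_linear_fst)
  have c: "smooth_on (U \<times> T) (\<lambda>u::'a \<times> 'a. f (fst u))" if "smooth_on U f" for f :: "'a \<Rightarrow> 'b"
    using that by (intro smooth_on_compose[OF o fst]) auto
  have "smooth_on (U \<times> T) (\<lambda>u::'a \<times> 'a. \<Sum>b\<in>Basis. (snd u \<bullet> b) *\<^sub>R frechet_derivative \<tau> (at (fst u)) b)"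
    by (intro smooth_on_sum smooth_on_scaleR o c smooth_on_frechet_derivative assms
        smooth_on_bounded_linear bounded_linear_inner_left_comp bounded_linear_snd)
  moreover have "(\<Sum>b\<in>Basis. (snd u \<bullet> b) *\<^sub>R frechet_derivative \<tau> (at (fst u)) b)
      = frechet_derivative \<tau> (at (fst u)) (snd u)" if "u \<in> U \<times> T" for u
  proof -
    have l: "linear (frechet_derivative \<tau> (at (fst u)))"
      using that assms(3) by (auto intro!: linear_frechet_derivative smooth_on_imp_differentiable)
    show ?thesis
      by (subst (2) euclidean_representation[of "snd u", symmetric])
        (simp only: linear_sum[OF l] linear_cmul[OF l])
  qed
  ultimately have "smooth_on (U \<times> T) (\<lambda>u. frechet_derivative \<tau> (at (fst u)) (snd u))"
    by (rule smooth_on_cong[OF o])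
  then show ?thesis by (intro smooth_on_Pair o c assms(3))
qed

text \<open>The transition map of two slit charts is the tangent map of the transition map of the charts.\<close>

lemma slit_atlas_smooth:
  fixes A :: "('p, 'e::euclidean_space) chart set"
  assumes A: "smooth_atlas A"
  shows "smooth_atlas (slit_atlas A)"
proof -
  have inj: "inj_on (snd (slit_chart A c)) (fst (slit_chart A c))" if "c \<in> A" for c
  proof (rule inj_onI)
    fix P Q assume PQ: "P \<in> fst (slit_chart A c)" "Q \<in> fst (slit_chart A c)"
      "snd (slit_chart A c) P = snd (slit_chart A c) Q"
    obtain p v q w where P: "P = (p, v)" and Q: "Q = (q, w)" by (metis surj_pair)
    from PQ have p: "p \<in> fst c" "q \<in> fst c" and v: "v \<in> tangent_space A p" "w \<in> tangent_space A q"
      and e: "snd c p = snd c q" "v c = w c"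
      unfolding P Q slit_chart_simps by auto
    have "p = q" using inj_onD[OF smooth_atlasD(1)[OF A that that] e(1) p] .
    with v(2) have w: "w \<in> tangent_space A p" by simp
    have "v = w" by (rule tangent_space_eqI[where c = c]) (fact v(1) w that p(1) e(2))+
    with \<open>p = q\<close> show "P = Q" unfolding P Q by blast
  qed
  have tr: "smooth_on ((snd c ` (fst c \<inter> fst d)) \<times> (- {0})) (transition (slit_chart A c) (slit_chart A d))"
    if cd: "c \<in> A" "d \<in> A" for c d
  proof (rule smooth_on_cong[OF _ smooth_on_tangent_map])
    show "open (snd c ` (fst c \<inter> fst d) \<times> (- {0}) :: ('e \<times> 'e) set)"
      by (intro open_Times smooth_atlasD(2)[OF A cd]) auto
    show "open (snd c ` (fst c \<inter> fst d))" "smooth_on (snd c ` (fst c \<inter> fst d)) (transition c d)"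
      using smooth_atlasD[OF A cd] by auto
    fix u :: "'e \<times> 'e" assume "u \<in> snd c ` (fst c \<inter> fst d) \<times> (- {0})"
    then obtain p y where u: "u = (snd c p, y)" "p \<in> fst c" "p \<in> fst d" "y \<noteq> 0" by auto
    have t: "tvec_of A c p y \<in> tangent_space A p" "tvec_of A c p y c = y"
      using tvec_of[OF A cd(1) u(2)] by auto
    then have "(p, tvec_of A c p y) \<in> fst (slit_chart A c)"
      using u by (auto simp: slit_chart_simps)
    then have "chart_inv (slit_chart A c) u = (p, tvec_of A c p y)"
      unfolding chart_inv_def
      by (intro inv_into_f_eq inj cd) (simp_all add: slit_chart_simps t u)
    then show "(transition c d (fst u), frechet_derivative (transition c d) (at (fst u)) (snd u))
        = transition (slit_chart A c) (slit_chart A d) u"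
      unfolding transition_def[of "slit_chart A c"] o_apply slit_chart_simps u(1) fst_conv snd_conv
      by (simp only: slit_chart_simps transition_coord[OF A cd(1) u(2)]
          tangent_space_coord[OF t(1) cd u(2,3)] t(2))
  qed auto
  show ?thesis
    unfolding smooth_atlas_def slit_atlas_def using inj tr
    by (auto simp: slit_chart_image_Int[OF A] intro!: open_Times smooth_atlasD(2)[OF A])
qed

lemma velocity_has_vector_derivative:
  assumes "smooth_curve A I \<gamma>" "t \<in> I" "c \<in> A" "\<gamma> t \<in> fst c"
  shows "((snd c \<circ> \<gamma>) has_vector_derivative velocity A \<gamma> t c) (at t)"
proof -
  have "smooth_on {t\<in>I. \<gamma> t \<in> fst c} (snd c \<circ> \<gamma>)"
    using assms by (simp add: smooth_curve_def)
  then have "(snd c \<circ> \<gamma>) differentiable (at t)"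
    by (rule smooth_on_imp_differentiable) (simp add: assms)
  then show ?thesis using assms by (simp add: velocity_def vector_derivative_works)
qed

lemma velocity_in_tangent_space:
  assumes A: "smooth_atlas A" and g: "smooth_curve A I \<gamma>" and t: "t \<in> I"
  shows "velocity A \<gamma> t \<in> tangent_space A (\<gamma> t)"
proof -
  have "velocity A \<gamma> t d = frechet_derivative (transition c d) (at (snd c (\<gamma> t))) (velocity A \<gamma> t c)"
    if cd: "c \<in> A" "d \<in> A" and p: "\<gamma> t \<in> fst c" "\<gamma> t \<in> fst d" for c d
  proof -
    have "((transition c d \<circ> (snd c \<circ> \<gamma>)) has_vector_derivative
        frechet_derivative (transition c d) (at (snd c (\<gamma> t))) (velocity A \<gamma> t c)) (at t)"
      by (rule vector_derivative_diff_chain_within[OF velocity_has_vector_derivative[OF g t cd(1) p(1)]])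
        (use transition_has_derivative[OF A cd p] in \<open>auto intro: has_derivative_at_withinI\<close>)
    then have "((snd d \<circ> \<gamma>) has_vector_derivative
        frechet_derivative (transition c d) (at (snd c (\<gamma> t))) (velocity A \<gamma> t c)) (at t)"
      by (rule has_vector_derivative_transform_within_open[where S = "{t\<in>I. \<gamma> t \<in> fst c}"])
        (use g t cd p in \<open>auto simp: smooth_curve_def transition_coord[OF A]\<close>)
    with velocity_has_vector_derivative[OF g t cd(2) p(2)] show ?thesis
      by (rule vector_derivative_unique_at)
  qed
  moreover have "velocity A \<gamma> t d = 0" if "d \<notin> A \<or> \<gamma> t \<notin> fst d" for d
    using that by (auto simp: velocity_def)
  ultimately show ?thesis unfolding tangent_space_def by blast
qed

lemma smooth_curve_chart:
  assumes A: "smooth_atlas A" and c: "c \<in> A" and I: "open I" and x: "smooth_on I x" "x ` I \<subseteq> snd c ` fst c"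
  shows "smooth_curve A I (\<lambda>t. chart_inv c (x t))"
proof -
  have in_c: "chart_inv c (x t) \<in> fst c" "snd c (chart_inv c (x t)) = x t" if "t \<in> I" for t
    using x(2) that chart_inv_image[of "x t" c] by auto
  have "open {t\<in>I. chart_inv c (x t) \<in> fst d} \<and>
      smooth_on {t\<in>I. chart_inv c (x t) \<in> fst d} (snd d \<circ> (\<lambda>t. chart_inv c (x t)))" if d: "d \<in> A" for d
  proof -
    let ?N = "snd c ` (fst c \<inter> fst d)" and ?J = "{t\<in>I. chart_inv c (x t) \<in> fst d}"
    have J: "?J = I \<inter> x -` ?N"
    proof (intro equalityI subsetI)
      fix t assume "t \<in> ?J"
      then show "t \<in> I \<inter> x -` ?N" using in_c[of t] by (auto intro: rev_image_eqI)
    next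
      fix t assume "t \<in> I \<inter> x -` ?N"
      then show "t \<in> ?J" using chart_inv_coord[OF A c] by auto
    qed
    have oJ: "open ?J"
      unfolding J using smooth_on_imp_continuous_on[OF x(1)] I smooth_atlasD(2)[OF A c d]
      by (rule continuous_open_preimage)
    have "smooth_on ?J (\<lambda>t. transition c d (x t))"
      by (rule smooth_on_compose[OF oJ smooth_on_subset[OF x(1)] smooth_atlasD(3)[OF A c d]])
        (use J in auto)
    with oJ show ?thesis by (simp add: transition_def o_def)
  qed
  then show ?thesis unfolding smooth_curve_def using I in_c c by auto
qed

lemma smooth_curve_velocity_lift:
  fixes A :: "('p, 'e::euclidean_space) chart set"
  assumes A: "smooth_atlas A" and g: "smooth_curve A I \<gamma>"
    and nz: "\<And>t. t \<in> I \<Longrightarrow> velocity A \<gamma> t \<noteq> zero_tvec"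
  shows "smooth_curve (slit_atlas A) I (\<lambda>t. (\<gamma> t, velocity A \<gamma> t))"
proof -
  have dom: "(\<gamma> t, velocity A \<gamma> t) \<in> fst (slit_chart A c) \<longleftrightarrow> \<gamma> t \<in> fst c" if "t \<in> I" for t c
    using nz[OF that] velocity_in_tangent_space[OF A g that] by (simp add: slit_chart_simps)
  have sm: "smooth_on {t\<in>I. \<gamma> t \<in> fst c} (snd (slit_chart A c) \<circ> (\<lambda>t. (\<gamma> t, velocity A \<gamma> t)))"
    if c: "c \<in> A" for c
  proof -
    let ?J = "{t\<in>I. \<gamma> t \<in> fst c}"
    have J: "open ?J" and s: "smooth_on ?J (snd c \<circ> \<gamma>)" using g c by (auto simp: smooth_curve_def)
    have "frechet_derivative (snd c \<circ> \<gamma>) (at t) 1 = velocity A \<gamma> t c" if "t \<in> ?J" for t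
    proof -
      have "((snd c \<circ> \<gamma>) has_derivative (\<lambda>h. h *\<^sub>R velocity A \<gamma> t c)) (at t)"
        using velocity_has_vector_derivative[OF g _ c] that by (simp add: has_vector_derivative_def)
      then show ?thesis by (simp add: frechet_derivative_eqI)
    qed
    then have "smooth_on ?J (\<lambda>t. velocity A \<gamma> t c)"
      by (rule smooth_on_cong[OF J smooth_on_frechet_derivative[OF s]])
    then show ?thesis using smooth_on_Pair[OF J s] by (simp add: o_def slit_chart_simps)
  qed
  have eq: "{t\<in>I. (\<gamma> t, velocity A \<gamma> t) \<in> fst (slit_chart A c)} = {t\<in>I. \<gamma> t \<in> fst c}" for c
    using dom[of _ c] by auto
  have cov: "(\<gamma> t, velocity A \<gamma> t) \<in> (\<Union>c\<in>slit_atlas A. fst c)" if t: "t \<in> I" for t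
  proof -
    obtain c where "c \<in> A" "\<gamma> t \<in> fst c" using g t unfolding smooth_curve_def by blast
    then show ?thesis using dom[OF t, of c] unfolding slit_atlas_def by blast
  qed
  show ?thesis
    unfolding smooth_curve_def
  proof (intro conjI ballI)
    show "open I" using g by (simp add: smooth_curve_def)
    show "(\<lambda>t. (\<gamma> t, velocity A \<gamma> t)) ` I \<subseteq> (\<Union>c\<in>slit_atlas A. fst c)"
      using cov by (rule image_subsetI)
  next
    fix D assume "D \<in> slit_atlas A"
    then obtain c where c: "c \<in> A" and D: "D = slit_chart A c" unfolding slit_atlas_def by blast
    show "open {t\<in>I. (\<gamma> t, velocity A \<gamma> t) \<in> fst D}"
      unfolding D eq using g c by (simp add: smooth_curve_def)
    show "smooth_on {t\<in>I. (\<gamma> t, velocity A \<gamma> t) \<in> fst D} (snd D \<circ> (\<lambda>t. (\<gamma> t, velocity A \<gamma> t)))"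
      unfolding D eq by (rule sm[OF c])
  qed
qed

text \<open>Equality of two tangent vectors can be tested in a single chart, so it suffices to solve the
  geodesic equation in one chart around each point of the curve.\<close>

lemma geodesicI:
  assumes A: "smooth_atlas A" and G: "vector_field (slit_atlas A) G"
    and I: "open I" "connected I" and g: "smooth_curve A I \<gamma>"
    and nz: "\<And>t. t \<in> I \<Longrightarrow> velocity A \<gamma> t \<noteq> zero_tvec"
    and eq: "\<And>t. t \<in> I \<Longrightarrow> \<exists>c\<in>A. \<gamma> t \<in> fst c \<and>
       ((\<lambda>s. (snd c (\<gamma> s), velocity A \<gamma> s c)) has_vector_derivative
          G (\<gamma> t, velocity A \<gamma> t) (slit_chart A c)) (at t)"
  shows "geodesic A G I \<gamma>"
proof -
  let ?\<Gamma> = "\<lambda>t. (\<gamma> t, velocity A \<gamma> t)"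
  have lift: "smooth_curve (slit_atlas A) I ?\<Gamma>"
    by (rule smooth_curve_velocity_lift[OF A g nz])
  have "velocity (slit_atlas A) ?\<Gamma> t = G (?\<Gamma> t)" if t: "t \<in> I" for t
  proof -
    obtain c where c: "c \<in> A" "\<gamma> t \<in> fst c" and d: "((\<lambda>s. (snd c (\<gamma> s), velocity A \<gamma> s c))
        has_vector_derivative G (?\<Gamma> t) (slit_chart A c)) (at t)"
      using eq[OF t] by blast
    have sc: "slit_chart A c \<in> slit_atlas A" "?\<Gamma> t \<in> fst (slit_chart A c)"
      using c nz[OF t] velocity_in_tangent_space[OF A g t] by (auto simp: slit_atlas_def slit_chart_simps)
    have "velocity (slit_atlas A) ?\<Gamma> t (slit_chart A c) = G (?\<Gamma> t) (slit_chart A c)"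
      using velocity_has_vector_derivative[OF lift t sc] d
      by (intro vector_derivative_unique_at) (auto simp: o_def slit_chart_simps)
    moreover have "G (?\<Gamma> t) \<in> tangent_space (slit_atlas A) (?\<Gamma> t)"
      using G sc unfolding vector_field_def by blast
    ultimately show ?thesis
      using tangent_space_eqI[OF velocity_in_tangent_space[OF slit_atlas_smooth[OF A] lift t] _ sc]
      by simp
  qed
  then show ?thesis
    using I g nz lift by (auto simp: geodesic_def integral_curve_def)
qed

section \<open>The coordinates \<open>(\<xi>, y)\<close> of the horizontal distribution\<close>

lemma vec_lambda_eq_sum_axis: "(\<chi> i. f i) = (\<Sum>i\<in>UNIV. f i *\<^sub>R axis i (1::real))"
  by (simp add: vec_eq_iff axis_def if_distrib cong: if_cong)

lemma bounded_linear_hor: "bounded_linear (hor \<iota>)"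
proof -
  have "linear (hor \<iota>)" by (auto intro!: linearI simp: hor_def vec_eq_iff)
  then show ?thesis by (rule linear_conv_bounded_linear[THEN iffD1])
qed

lemma bounded_linear_L_components: "bounded_linear (L_components \<iota>)"
  unfolding L_components_def
  by (intro bounded_linear_Pair bounded_linear_fst bounded_linear_compose[OF bounded_linear_hor] bounded_linear_snd)

lemma graph_point_fst [simp]: "fst (graph_point \<iota> l u) = fst u"
  by (simp add: graph_point_def)

lemma hor_graph_point: "inj \<iota> \<Longrightarrow> hor \<iota> (snd (graph_point \<iota> l u)) = snd u"
  by (simp add: hor_def graph_point_def vec_eq_iff)

lemma L_components_graph_point: "inj \<iota> \<Longrightarrow> L_components \<iota> (graph_point \<iota> l u) = u"
  by (simp add: L_components_def hor_graph_point)

locale submersion_coordinates =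
  fixes Ab :: "('p::{t2_space, second_countable_topology}, real^'m) chart set"
    and A :: "('q::{t2_space, second_countable_topology}, real^'n) chart set"
    and Gb :: "('p, real^'m) bundle_field" and G :: "('q, real^'n) bundle_field"
    and \<pi> :: "'p \<Rightarrow> 'q" and L :: "'p \<Rightarrow> ('p, real^'m) tvec set"
    and \<iota> :: "'n::finite \<Rightarrow> 'm::finite"
    and cb :: "('p, real^'m) chart" and c :: "('q, real^'n) chart"
    and l :: "'m \<Rightarrow> (real^'m) \<times> (real^'n) \<Rightarrow> real"
  assumes atlas_b: "smooth_atlas Ab" and atlas: "smooth_atlas A"
    and submersion: "spray_submersion Ab Gb A G \<pi> L"
    and inj: "inj \<iota>" and cb: "cb \<in> Ab" and c: "c \<in> A" and adapted: "adapted_charts \<iota> \<pi> cb c"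
    and graph: "is_graph_of \<iota> Ab cb L l"
begin

abbreviation U where "U \<equiv> snd cb ` fst cb"

text \<open>The domain of the coordinates \<open>(\<xi>, y)\<close> on \<open>L\<close> minus its zero section.\<close>

definition D :: "((real^'m) \<times> (real^'n)) set" where "D = U \<times> (- {0})"

abbreviation g where "g \<equiv> graph_point \<iota> l"

text \<open>The horizontal lift: \<open>horlift (\<xi>, y)\<close> is the vector of \<open>L\<close> at \<open>\<xi>\<close> that projects to \<open>y\<close>.\<close>

abbreviation horlift where "horlift u \<equiv> snd (graph_point \<iota> l u)"

abbreviation V where "V u \<equiv> local_rep (slit_chart Ab cb) Gb (graph_point \<iota> l u)"

lemma open_U: "open U" by (rule smooth_atlas_open_image[OF atlas_b cb])

lemma open_D: "open D" unfolding D_def by (intro open_Times open_U) auto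

lemma graph_smooth: "smooth_on (U \<times> UNIV) g"
proof -
  have o: "open (U \<times> (UNIV :: (real^'n) set))" by (intro open_Times open_U open_UNIV)
  have 1: "smooth_on (U \<times> UNIV) (\<lambda>u. (if B \<in> range \<iota> then snd u $ (inv \<iota> B) else l B u) *\<^sub>R axis B (1::real))"
    for B
  proof (cases "B \<in> range \<iota>")
    case True
    have "bounded_linear (\<lambda>u::(real^'m) \<times> (real^'n). (snd u $ (inv \<iota> B)) *\<^sub>R axis B (1::real))"
      by (intro bounded_linear_scaleR_const bounded_linear_compose[OF bounded_linear_vec_nth] bounded_linear_snd)
    from smooth_on_bounded_linear[OF o this] True show ?thesis by simp
  next
    case False
    then have "smooth_on (U \<times> UNIV) (l B)" using graph by (simp add: is_graph_of_def)
    with smooth_on_scaleR[OF o this smooth_on_const[OF o]] False show ?thesis by simp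
  qed
  have e: "g = (\<lambda>u. (fst u, \<Sum>B\<in>UNIV. (if B \<in> range \<iota> then snd u $ (inv \<iota> B) else l B u) *\<^sub>R axis B (1::real)))"
    by (rule ext) (simp only: graph_point_def vec_lambda_eq_sum_axis)
  show ?thesis
    unfolding e by (intro smooth_on_Pair o smooth_on_sum 1 smooth_on_bounded_linear bounded_linear_fst)
qed

lemma D_subset: "D \<subseteq> U \<times> UNIV" by (auto simp: D_def)

lemma graph_has_derivative:
  "u \<in> D \<Longrightarrow> (g has_derivative frechet_derivative g (at u)) (at u)"
  using D_subset by (intro has_derivative_frechet smooth_on_imp_differentiable[OF graph_smooth]) auto

lemma hor_horlift: "hor \<iota> (horlift u) = snd u"
  by (rule hor_graph_point[OF inj])

lemma horlift_nonzero:
  assumes "u \<in> D" shows "horlift u \<noteq> 0"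
proof
  assume "horlift u = 0"
  then have "snd u = hor \<iota> 0" using hor_horlift by metis
  then have "snd u = 0" by (simp add: linear_simps[OF bounded_linear_hor])
  with assms show False by (auto simp: D_def)
qed

lemma graph_in_slit: "u \<in> D \<Longrightarrow> g u \<in> U \<times> (- {0})"
  using horlift_nonzero[of u] by (auto simp: D_def mem_Times_iff)

lemma spray_b: "vector_field (slit_atlas Ab) Gb" "spray Ab Gb"
  and spray_base: "vector_field (slit_atlas A) G" "spray A G"
  using submersion by (auto simp: spray_submersion_def spray_def)

lemma V_components:
  assumes "u \<in> D" shows "V u = (horlift u, -2 *\<^sub>R spray_coeff Ab Gb cb (g u))"
proof -
  have "fst (V u) = horlift u"
    using spray_b(2) cb graph_in_slit[OF assms] unfolding spray_def
    by (metis ComplD mem_Times_iff prod.collapse singletonI)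
  then show ?thesis by (simp add: spray_coeff_def prod_eq_iff)
qed

lemma spray_smooth:
  "smooth_on (U \<times> (- {0})) (local_rep (slit_chart Ab cb) Gb)"
  "smooth_on ((snd c ` fst c) \<times> (- {0})) (local_rep (slit_chart A c) G)"
  using spray_b(1) spray_base(1) cb c
    slit_chart_image[OF atlas_b cb] slit_chart_image[OF atlas c]
  unfolding vector_field_def slit_atlas_def by (metis (no_types, lifting) imageI)+

lemma V_smooth: "smooth_on D (\<lambda>u. V u)"
  by (rule smooth_on_compose[OF open_D smooth_on_subset[OF graph_smooth D_subset] spray_smooth(1)])
    (use graph_in_slit in blast)

lemma in_L_iff:
  assumes "p \<in> fst cb" "v \<in> tangent_space Ab p"
  shows "v \<in> L p \<longleftrightarrow> v cb = horlift (snd cb p, hor \<iota> (v cb))"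
proof -
  have r: "v cb $ \<iota> i = hor \<iota> (v cb) $ i" for i by (simp add: hor_def)
  have "v cb = horlift (snd cb p, hor \<iota> (v cb)) \<longleftrightarrow>
      (\<forall>\<alpha>. \<alpha> \<notin> range \<iota> \<longrightarrow> v cb $ \<alpha> = l \<alpha> (snd cb p, hor \<iota> (v cb)))"
    unfolding vec_eq_iff graph_point_def using r inj by (auto simp: inv_f_f)
  then show ?thesis using graph assms unfolding is_graph_of_def by blast
qed

text \<open>The point of \<open>L\<close> with coordinates \<open>u\<close>, recovered by inverting the slit chart.\<close>

lemma slit_point:
  assumes "u \<in> D"
  obtains p v where "chart_inv (slit_chart Ab cb) (g u) = (p, v)" "p \<in> fst cb"
    "v \<in> tangent_space Ab p" "v \<noteq> zero_tvec" "snd cb p = fst u" "v cb = horlift u" "v \<in> L p"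
proof -
  obtain p v where pv: "chart_inv (slit_chart Ab cb) (g u) = (p, v)" by fastforce
  have im: "g u \<in> snd (slit_chart Ab cb) ` fst (slit_chart Ab cb)"
    using graph_in_slit[OF assms] slit_chart_image[OF atlas_b cb] by simp
  have in1: "p \<in> fst cb" "v \<in> tangent_space Ab p" "v \<noteq> zero_tvec"
    using chart_inv_image(1)[OF im] pv by (auto simp: slit_chart_simps)
  have e: "snd cb p = fst u" "v cb = horlift u"
    using chart_inv_image(2)[OF im] pv by (auto simp: slit_chart_simps prod_eq_iff)
  have "v \<in> L p" using in_L_iff[OF in1(1,2)] e by (simp add: hor_horlift)
  with that pv in1 e show ?thesis by blast
qed

text \<open>A curve inside \<open>L\<close> satisfies \<open>\<phi> = g (L_components \<phi>)\<close>. Differentiating this along the curve that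
  witnesses the tangency of the spray to \<open>L\<close> shows that the spray is determined by its components in
  the chart \<open>(\<xi>, y)\<close>.\<close>

lemma V_tangent:
  assumes u: "u \<in> D"
  shows "frechet_derivative g (at u) (L_components \<iota> (V u)) = V u"
proof -
  obtain p v where pv: "chart_inv (slit_chart Ab cb) (g u) = (p, v)" "p \<in> fst cb"
    "v \<in> tangent_space Ab p" "v \<noteq> zero_tvec" "snd cb p = fst u" "v cb = horlift u" "v \<in> L p"
    using slit_point[OF u] .
  have sc: "slit_chart Ab cb \<in> slit_atlas Ab" using cb by (simp add: slit_atlas_def)
  have "(p, v) \<in> slit_subbundle L" using pv by (simp add: slit_subbundle_def)
  then have "tangent_to (slit_atlas Ab) (slit_subbundle L) (p, v) (Gb (p, v))"
    using submersion unfolding spray_submersion_def by blast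
  then obtain \<gamma> e where e: "e > 0" and sm: "smooth_curve (slit_atlas Ab) {-e<..<e} \<gamma>"
    and g0: "\<gamma> 0 = (p, v)" and gL: "\<gamma> ` {-e<..<e} \<subseteq> slit_subbundle L"
    and vel: "velocity (slit_atlas Ab) \<gamma> 0 = Gb (p, v)"
    unfolding tangent_to_def by blast
  let ?\<phi> = "snd (slit_chart Ab cb) \<circ> \<gamma>"
  let ?J = "{t\<in>{-e<..<e}. \<gamma> t \<in> fst (slit_chart Ab cb)}"
  have J: "open ?J" using sm sc unfolding smooth_curve_def by blast
  have 0: "0 \<in> {-e<..<e}" "\<gamma> 0 \<in> fst (slit_chart Ab cb)"
    using e g0 pv by (auto simp: slit_chart_simps)
  have d: "(?\<phi> has_vector_derivative V u) (at 0)"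
    using velocity_has_vector_derivative[OF sm 0(1) sc 0(2)] by (simp add: vel local_rep_def pv(1))
  have fix_J: "g (L_components \<iota> (?\<phi> t)) = ?\<phi> t" if t: "t \<in> ?J" for t
  proof -
    obtain q w where qw: "\<gamma> t = (q, w)" by fastforce
    have "\<gamma> t \<in> slit_subbundle L" using t gL by blast
    then have "w \<in> L q" "q \<in> fst cb" "w \<in> tangent_space Ab q"
      using t qw by (auto simp: slit_chart_simps slit_subbundle_def)
    then have "w cb = horlift (snd cb q, hor \<iota> (w cb))" using in_L_iff by blast
    then show ?thesis by (simp add: qw slit_chart_simps L_components_def prod_eq_iff)
  qed
  have "?\<phi> 0 = g u" by (simp add: g0 slit_chart_simps pv prod_eq_iff)
  then have u0: "L_components \<iota> (?\<phi> 0) = u" by (simp add: L_components_graph_point[OF inj])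
  have "((\<lambda>t. L_components \<iota> (?\<phi> t)) has_vector_derivative L_components \<iota> (V u)) (at 0)"
    by (rule bounded_linear.has_vector_derivative[OF bounded_linear_L_components d])
  then have "((g \<circ> (\<lambda>t. L_components \<iota> (?\<phi> t))) has_vector_derivative
      frechet_derivative g (at u) (L_components \<iota> (V u))) (at 0)"
    by (rule vector_derivative_diff_chain_within)
      (unfold u0, rule has_derivative_at_withinI[OF graph_has_derivative[OF u]])
  then have "(?\<phi> has_vector_derivative frechet_derivative g (at u) (L_components \<iota> (V u))) (at 0)"
    by (rule has_vector_derivative_transform_within_open[OF _ J]) (use 0 fix_J in auto)
  then show ?thesis using d by (rule vector_derivative_unique_at)
qed

text \<open>Here the condition on geodesics enters. The spray restricts to a vector field \<open>F\<close> in the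
  coordinates \<open>(\<xi>, y)\<close>, because it is tangent to \<open>L\<close>; an integral curve of \<open>F\<close> through \<open>u\<close> gives a geodesic
  of the total space with velocity in \<open>L\<close>. Its projection is a geodesic of the base with velocity
  \<open>y(t)\<close>, and comparing the two expressions of \<open>y'(0)\<close> identifies the spray coefficients.\<close>

lemma hor_spray_coeff:
  assumes u: "u \<in> D"
  shows "hor \<iota> (spray_coeff Ab Gb cb (g u)) = spray_coeff A G c (hor \<iota> (fst u), snd u)"
proof -
  define F where "F u = L_components \<iota> (V u)" for u
  have F: "smooth_on D F"
    unfolding F_def by (rule smooth_on_bounded_linear_compose[OF open_D bounded_linear_L_components V_smooth])
  then have "Ck_on 1 D F" by (simp add: smooth_on_def)
  then obtain e x where e: "0 < e" and x0: "x 0 = u"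
    and x: "\<And>t. t \<in> {-e<..<e} \<Longrightarrow> x t \<in> D \<and> (x has_vector_derivative F (x t)) (at t)"
    using ode_local_solution[OF open_D _ u] by blast
  define I where "I = {-e<..<e}"
  have I: "open I" "connected I" "0 \<in> I" by (auto simp: I_def e)
  have xD: "x t \<in> D" and xd: "(x has_vector_derivative F (x t)) (at t)" if "t \<in> I" for t
    using x that by (auto simp: I_def)
  have xs: "smooth_on I x" by (rule ode_solution_smooth[OF I(1) F]) (use xD xd in blast)
  define \<gamma> where "\<gamma> t = chart_inv cb (fst (x t))" for t
  have xU: "fst (x t) \<in> U" if "t \<in> I" for t using xD[OF that] by (auto simp: D_def)
  have g_cb: "\<gamma> t \<in> fst cb" "snd cb (\<gamma> t) = fst (x t)" if "t \<in> I" for t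
    unfolding \<gamma>_def using chart_inv_image[OF xU[OF that]] by auto
  have g_smooth: "smooth_curve Ab I \<gamma>"
    unfolding \<gamma>_def
    by (rule smooth_curve_chart[OF atlas_b cb I(1)])
      (use xU smooth_on_bounded_linear_compose[OF I(1) bounded_linear_fst xs] in auto)
  have vel_cb: "velocity Ab \<gamma> t cb = horlift (x t)" if t: "t \<in> I" for t
  proof -
    have "((\<lambda>t. fst (x t)) has_vector_derivative fst (F (x t))) (at t)"
      by (rule bounded_linear.has_vector_derivative[OF bounded_linear_fst xd[OF t]])
    then have "((snd cb \<circ> \<gamma>) has_vector_derivative fst (F (x t))) (at t)"
      by (rule has_vector_derivative_transform_within_open[OF _ I(1) t]) (simp add: g_cb)
    then have "velocity Ab \<gamma> t cb = fst (F (x t))"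
      using velocity_has_vector_derivative[OF g_smooth t cb g_cb(1)[OF t]] vector_derivative_unique_at by blast
    then show ?thesis using V_components[OF xD[OF t]] by (simp add: F_def L_components_def)
  qed
  have vel_ts: "velocity Ab \<gamma> t \<in> tangent_space Ab (\<gamma> t)" if "t \<in> I" for t
    by (rule velocity_in_tangent_space[OF atlas_b g_smooth that])
  have vel_nz: "velocity Ab \<gamma> t \<noteq> zero_tvec" if t: "t \<in> I" for t
    using horlift_nonzero[OF xD[OF t]] vel_cb[OF t] by auto
  have vel_L: "(\<gamma> t, velocity Ab \<gamma> t) \<in> slit_subbundle L" if t: "t \<in> I" for t
    using in_L_iff[OF g_cb(1)[OF t] vel_ts[OF t]] vel_cb[OF t] g_cb(2)[OF t] vel_nz[OF t]
    by (simp add: slit_subbundle_def hor_horlift)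
  have "geodesic Ab Gb I \<gamma>"
  proof (rule geodesicI[OF atlas_b spray_b(1) I(1,2) g_smooth vel_nz], assumption)
    fix t assume t: "t \<in> I"
    have "((g \<circ> x) has_vector_derivative frechet_derivative g (at (x t)) (F (x t))) (at t)"
      by (rule vector_derivative_diff_chain_within[OF xd[OF t]])
        (rule has_derivative_at_withinI[OF graph_has_derivative[OF xD[OF t]]])
    moreover have "frechet_derivative g (at (x t)) (F (x t)) = V (x t)"
      unfolding F_def by (rule V_tangent[OF xD[OF t]])
    moreover have "V (x t) = Gb (\<gamma> t, velocity Ab \<gamma> t) (slit_chart Ab cb)"
    proof -
      have m: "(\<gamma> t, velocity Ab \<gamma> t) \<in> fst (slit_chart Ab cb)"
        using g_cb[OF t] vel_ts[OF t] vel_nz[OF t] by (simp add: slit_chart_simps)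
      have "g (x t) = snd (slit_chart Ab cb) (\<gamma> t, velocity Ab \<gamma> t)"
        by (simp add: slit_chart_simps g_cb[OF t] vel_cb[OF t] prod_eq_iff)
      then have "chart_inv (slit_chart Ab cb) (g (x t)) = (\<gamma> t, velocity Ab \<gamma> t)"
        using chart_inv_coord[OF slit_atlas_smooth[OF atlas_b] _ m] cb by (simp add: slit_atlas_def)
      then show ?thesis by (simp add: local_rep_def)
    qed
    ultimately have "((g \<circ> x) has_vector_derivative
        Gb (\<gamma> t, velocity Ab \<gamma> t) (slit_chart Ab cb)) (at t)" by simp
    then have "((\<lambda>s. (snd cb (\<gamma> s), velocity Ab \<gamma> s cb)) has_vector_derivative
        Gb (\<gamma> t, velocity Ab \<gamma> t) (slit_chart Ab cb)) (at t)"
      by (rule has_vector_derivative_transform_within_open[OF _ I(1) t])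
        (simp add: g_cb vel_cb prod_eq_iff)
    with cb g_cb(1)[OF t] show "\<exists>d\<in>Ab. \<gamma> t \<in> fst d \<and>
       ((\<lambda>s. (snd d (\<gamma> s), velocity Ab \<gamma> s d)) has_vector_derivative
          Gb (\<gamma> t, velocity Ab \<gamma> t) (slit_chart Ab d)) (at t)" by blast
  qed
  \<comment> \<open>The acceleration of the projected geodesic at time \<open>0\<close> is computed once from the spray of the base
    and once from the differential equation for \<open>x\<close>.\<close>
  then have geo: "geodesic A G I (\<pi> \<circ> \<gamma>)"
    using submersion vel_L unfolding spray_submersion_def by blast
  let ?c = "\<pi> \<circ> \<gamma>" and ?\<Gamma> = "\<lambda>t. ((\<pi> \<circ> \<gamma>) t, velocity A (\<pi> \<circ> \<gamma>) t)"
  have c_smooth: "smooth_curve A I ?c" and c_nz: "\<And>t. t \<in> I \<Longrightarrow> velocity A ?c t \<noteq> zero_tvec"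
    and lift: "smooth_curve (slit_atlas A) I ?\<Gamma>"
    and int: "\<And>t. t \<in> I \<Longrightarrow> velocity (slit_atlas A) ?\<Gamma> t = G (?\<Gamma> t)"
    using geo by (auto simp: geodesic_def integral_curve_def)
  have c_c: "?c t \<in> fst c" "snd c (?c t) = hor \<iota> (fst (x t))" if "t \<in> I" for t
    using adapted g_cb[OF that] by (auto simp: adapted_charts_def)
  have vel_c: "velocity A ?c t c = snd (x t)" if t: "t \<in> I" for t
  proof -
    have "((\<lambda>t. hor \<iota> (fst (x t))) has_vector_derivative hor \<iota> (fst (F (x t)))) (at t)"
      by (intro bounded_linear.has_vector_derivative[OF bounded_linear_hor]
          bounded_linear.has_vector_derivative[OF bounded_linear_fst xd[OF t]])
    then have "((snd c \<circ> ?c) has_vector_derivative hor \<iota> (fst (F (x t)))) (at t)"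
      by (rule has_vector_derivative_transform_within_open[OF _ I(1) t]) (use c_c in simp)
    then have "velocity A ?c t c = hor \<iota> (fst (F (x t)))"
      using velocity_has_vector_derivative[OF c_smooth t c c_c(1)[OF t]] vector_derivative_unique_at by blast
    then show ?thesis
      using V_components[OF xD[OF t]] by (simp add: F_def L_components_def hor_horlift)
  qed
  have sc: "slit_chart A c \<in> slit_atlas A" using c by (simp add: slit_atlas_def)
  have G0: "?\<Gamma> 0 \<in> fst (slit_chart A c)"
    using c_c(1)[OF I(3)] c_nz[OF I(3)] velocity_in_tangent_space[OF atlas c_smooth I(3)]
    by (simp add: slit_chart_simps)
  have "((snd (slit_chart A c) \<circ> ?\<Gamma>) has_vector_derivative G (?\<Gamma> 0) (slit_chart A c)) (at 0)"
    using velocity_has_vector_derivative[OF lift I(3) sc G0] by (simp only: int[OF I(3)])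
  then have "((\<lambda>t. snd ((snd (slit_chart A c) \<circ> ?\<Gamma>) t)) has_vector_derivative
      snd (G (?\<Gamma> 0) (slit_chart A c))) (at 0)"
    by (rule bounded_linear.has_vector_derivative[OF bounded_linear_snd])
  then have "((\<lambda>t. snd (x t)) has_vector_derivative snd (G (?\<Gamma> 0) (slit_chart A c))) (at 0)"
    by (rule has_vector_derivative_transform_within_open[OF _ I(1) I(3)])
      (use vel_c in \<open>simp add: slit_chart_simps\<close>)
  moreover have "((\<lambda>t. snd (x t)) has_vector_derivative snd (F (x 0))) (at 0)"
    by (rule bounded_linear.has_vector_derivative[OF bounded_linear_snd xd[OF I(3)]])
  ultimately have "snd (G (?\<Gamma> 0) (slit_chart A c)) = snd (F u)"
    using x0 vector_derivative_unique_at by metis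
  moreover have "chart_inv (slit_chart A c) (hor \<iota> (fst u), snd u) = ?\<Gamma> 0"
  proof -
    have "snd (slit_chart A c) (?\<Gamma> 0) = (hor \<iota> (fst u), snd u)"
      using c_c(2)[OF I(3)] vel_c[OF I(3)] x0 by (simp add: slit_chart_simps)
    then show ?thesis using chart_inv_coord[OF slit_atlas_smooth[OF atlas] sc G0] by simp
  qed
  ultimately have "spray_coeff A G c (hor \<iota> (fst u), snd u) = (-1/2) *\<^sub>R snd (F u)"
    by (simp add: spray_coeff_def local_rep_def)
  also have "snd (F u) = -2 *\<^sub>R hor \<iota> (spray_coeff Ab Gb cb (g u))"
    unfolding F_def L_components_def V_components[OF u]
    by (simp add: linear_simps[OF bounded_linear_hor])
  finally show ?thesis by simp
qed

end

section \<open>The curvature as a bilinear expression in derivatives of the spray\<close>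

lemma vec_expand_axis: "(v :: real^'n) = (\<Sum>i\<in>UNIV. v $ i *\<^sub>R axis i 1)"
  using vec_lambda_eq_sum_axis[of "\<lambda>i. v $ i"] by simp

lemma linear_sum_axis:
  fixes f :: "real^'n \<Rightarrow> 'b::real_vector"
  assumes "linear f"
  shows "f v = (\<Sum>i\<in>UNIV. v $ i *\<^sub>R f (axis i 1))"
  by (subst vec_expand_axis) (simp only: linear_sum[OF assms] linear_cmul[OF assms])

lemma linear_fst_part: "linear f \<Longrightarrow> linear (\<lambda>v. f (v, 0))"
  by (rule linear_compose[of "\<lambda>v. (v, 0)" f, unfolded o_def]) (auto intro!: linearI)

lemma linear_snd_part: "linear f \<Longrightarrow> linear (\<lambda>v. f (0, v))"
  by (rule linear_compose[of "\<lambda>v. (0, v)" f, unfolded o_def]) (auto intro!: linearI)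

lemma linear_Pair_split:
  assumes "linear f"
  shows "f (v, w) = f (v, 0) + f (0, w)"
  using linear_add[OF assms, of "(v, 0)" "(0, w)"] by simp

lemma frechet_derivative_bounded_linear_compose:
  assumes "bounded_linear h" "f differentiable (at x)"
  shows "frechet_derivative (\<lambda>x. h (f x)) (at x) v = h (frechet_derivative f (at x) v)"
  by (rule fun_cong[OF frechet_derivative_eqI])
    (rule bounded_linear.has_derivative[OF assms(1) has_derivative_frechet[OF assms(2)]])

text \<open>With \<open>N(u) b = DG(u)(0, b)\<close>, the curvature applied to \<open>b\<close> is
  \<open>2 DG(b, 0) - D(N b)(y, -2G) - N (N b)\<close>: the two terms with second derivatives combine into the
  derivative of \<open>N b\<close> along the spray \<open>(y, -2G)\<close>. In this form the curvature can be recognized in the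
  bracket without splitting it into coordinates.\<close>

lemma riemann_curvature_contract:
  fixes G :: "(real^'n) \<times> (real^'n) \<Rightarrow> real^'n"
  assumes S: "open S" "smooth_on S G" "u \<in> S"
  shows "(\<Sum>k\<in>UNIV. b $ k * riemann_curvature G i k u) =
    (2 *\<^sub>R frechet_derivative G (at u) (b, 0)
     - frechet_derivative (\<lambda>u. frechet_derivative G (at u) (0, b)) (at u) (snd u, -2 *\<^sub>R G u)
     - frechet_derivative G (at u) (0, frechet_derivative G (at u) (0, b))) $ i"
proof -
  define DG where "DG = frechet_derivative G (at u)"
  define E where "E v = frechet_derivative (\<lambda>u. frechet_derivative G (at u) v) (at u)" for v
  have dG: "G differentiable (at w)" if "w \<in> S" for w
    using smooth_on_imp_differentiable[OF S(2) that] .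
  have dE: "(\<lambda>u. frechet_derivative G (at u) v) differentiable (at u)" for v
    using smooth_on_imp_differentiable[OF smooth_on_frechet_derivative[OF S(2)] S(3)] .
  have lDG: "linear (frechet_derivative G (at w))" if "w \<in> S" for w
    by (rule linear_frechet_derivative[OF dG[OF that]])
  have lE: "linear (E v)" for v unfolding E_def by (rule linear_frechet_derivative[OF dE])
  note comp = frechet_derivative_bounded_linear_compose[OF bounded_linear_vec_nth]
  have pb: "pd_base k (\<lambda>u. G u $ i) u = DG (axis k 1, 0) $ i" for k
    unfolding pd_base_def DG_def by (rule comp[OF dG[OF S(3)]])
  have pf: "pd_fibre k (\<lambda>u. G u $ i) w = frechet_derivative G (at w) (0, axis k 1) $ i"
    if "w \<in> S" for k i w
    unfolding pd_fibre_def by (rule comp[OF dG[OF that]])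
  have pp: "frechet_derivative (pd_fibre k (\<lambda>u. G u $ i)) (at u) v = E (0, axis k 1) v $ i" for k v
  proof -
    have "((\<lambda>u. frechet_derivative G (at u) (0, axis k 1) $ i) has_derivative (\<lambda>v. E (0, axis k 1) v $ i)) (at u)"
      unfolding E_def by (rule bounded_linear.has_derivative[OF bounded_linear_vec_nth has_derivative_frechet[OF dE]])
    then have "(pd_fibre k (\<lambda>u. G u $ i) has_derivative (\<lambda>v. E (0, axis k 1) v $ i)) (at u)"
      by (rule has_derivative_transform_within_open[OF _ S(1,3)]) (simp add: pf)
    then show ?thesis by (rule fun_cong[OF frechet_derivative_eqI])
  qed
  have Eb: "E (0, b) v = (\<Sum>k\<in>UNIV. b $ k *\<^sub>R E (0, axis k 1) v)" for v
  proof -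
    have "((\<lambda>u. \<Sum>k\<in>UNIV. b $ k *\<^sub>R frechet_derivative G (at u) (0, axis k 1)) has_derivative
        (\<lambda>v. \<Sum>k\<in>UNIV. b $ k *\<^sub>R E (0, axis k 1) v)) (at u)"
      unfolding E_def
      by (intro has_derivative_sum has_derivative_scaleR_right has_derivative_frechet[OF dE])
    then have "((\<lambda>u. frechet_derivative G (at u) (0, b)) has_derivative
        (\<lambda>v. \<Sum>k\<in>UNIV. b $ k *\<^sub>R E (0, axis k 1) v)) (at u)"
      by (rule has_derivative_transform_within_open[OF _ S(1,3)])
        (simp add: linear_sum_axis[OF linear_snd_part[OF lDG], of _ b])
    then show ?thesis unfolding E_def by (rule fun_cong[OF frechet_derivative_eqI])
  qed
  have Ek: "E v (snd u, -2 *\<^sub>R G u) = (\<Sum>j\<in>UNIV. snd u $ j *\<^sub>R E v (axis j 1, 0))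
      - 2 *\<^sub>R (\<Sum>j\<in>UNIV. G u $ j *\<^sub>R E v (0, axis j 1))" for v
  proof -
    have "E v (snd u, -2 *\<^sub>R G u) = E v (snd u, 0) + E v (0, -2 *\<^sub>R G u)"
      by (rule linear_Pair_split[OF lE])
    also have "E v (0, -2 *\<^sub>R G u) = -2 *\<^sub>R E v (0, G u)"
      by (rule linear_cmul[OF linear_snd_part[OF lE]])
    also have "E v (0, G u) = (\<Sum>j\<in>UNIV. G u $ j *\<^sub>R E v (0, axis j 1))"
      by (rule linear_sum_axis[OF linear_snd_part[OF lE]])
    also have "E v (snd u, 0) = (\<Sum>j\<in>UNIV. snd u $ j *\<^sub>R E v (axis j 1, 0))"
      by (rule linear_sum_axis[OF linear_fst_part[OF lE]])
    finally show ?thesis by simp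
  qed
  have R: "riemann_curvature G i k u = (2 *\<^sub>R DG (axis k 1, 0) - E (0, axis k 1) (snd u, -2 *\<^sub>R G u)
      - DG (0, DG (0, axis k 1))) $ i" for k
  proof -
    have "DG (0, DG (0, axis k 1)) = (\<Sum>j\<in>UNIV. DG (0, axis k 1) $ j *\<^sub>R DG (0, axis j 1))"
      unfolding DG_def by (rule linear_sum_axis[OF linear_snd_part[OF lDG[OF S(3)]]])
    then show ?thesis
      unfolding riemann_curvature_def Ek pb pf[OF S(3)] pd_base_def[of _ "pd_fibre _ _"]
        pd_fibre_def[of _ "pd_fibre _ _"] pp
      by (simp add: DG_def[symmetric] algebra_simps)
  qed
  have l: "linear DG" unfolding DG_def by (rule lDG[OF S(3)])
  have 1: "DG (b, 0) = (\<Sum>k\<in>UNIV. b $ k *\<^sub>R DG (axis k 1, 0))"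
    by (rule linear_sum_axis[OF linear_fst_part[OF l]])
  have 2: "DG (0, DG (0, b)) = (\<Sum>k\<in>UNIV. b $ k *\<^sub>R DG (0, DG (0, axis k 1)))"
    by (rule linear_sum_axis) (rule linear_compose[OF linear_snd_part[OF l] linear_snd_part[OF l], unfolded o_def])
  show ?thesis
    unfolding R DG_def[symmetric] E_def[symmetric] 1 2 Eb
    by (simp add: sum_distrib_left sum_subtractf sum.distrib algebra_simps)
qed

section \<open>The bracket with the spray\<close>

context submersion_coordinates
begin

abbreviation Gc where "Gc \<equiv> spray_coeff A G c"
abbreviation Gbc where "Gbc \<equiv> spray_coeff Ab Gb cb"

text \<open>The restriction to \<open>L\<close> of the tangent map of \<open>\<pi>\<close>, in coordinates.\<close>

abbreviation \<kappa> :: "(real^'m) \<times> (real^'n) \<Rightarrow> (real^'n) \<times> (real^'n)" where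
  "\<kappa> u \<equiv> (hor \<iota> (fst u), snd u)"

abbreviation DGc where "DGc u \<equiv> frechet_derivative (spray_coeff A G c) (at u)"

lemma bounded_linear_\<kappa>: "bounded_linear \<kappa>"
  by (intro bounded_linear_Pair bounded_linear_snd bounded_linear_compose[OF bounded_linear_hor] bounded_linear_fst)

lemma open_base: "open ((snd c ` fst c) \<times> (- {0}) :: ((real^'n) \<times> (real^'n)) set)"
  by (intro open_Times smooth_atlas_open_image[OF atlas c]) auto

lemma \<kappa>_in_base: "u \<in> D \<Longrightarrow> \<kappa> u \<in> (snd c ` fst c) \<times> (- {0})"
  using adapted unfolding adapted_charts_def D_def by (auto intro!: rev_image_eqI)

lemma Gc_smooth: "smooth_on ((snd c ` fst c) \<times> (- {0})) Gc"
  unfolding spray_coeff_def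
  by (rule smooth_on_bounded_linear_compose[OF open_base _ spray_smooth(2)])
    (intro bounded_linear_const_scaleR bounded_linear_snd)

lemma Gbc_smooth: "smooth_on (U \<times> (- {0})) Gbc"
  unfolding spray_coeff_def
  by (rule smooth_on_bounded_linear_compose[OF _ _ spray_smooth(1)])
    (intro open_Times open_U open_Compl closed_singleton bounded_linear_const_scaleR bounded_linear_snd)+

lemma Gc_has_derivative: "u \<in> D \<Longrightarrow> (Gc has_derivative DGc (\<kappa> u)) (at (\<kappa> u))"
  by (intro has_derivative_frechet smooth_on_imp_differentiable[OF Gc_smooth] \<kappa>_in_base)

lemma linear_DGc: "u \<in> D \<Longrightarrow> linear (DGc (\<kappa> u))"
  by (rule has_derivative_linear[OF Gc_has_derivative])

lemma linear_horlift:
  assumes "\<xi> \<in> U" shows "linear (\<lambda>y. horlift (\<xi>, y))"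
proof -
  have l: "linear (\<lambda>y. l \<alpha> (\<xi>, y))" if "\<alpha> \<notin> range \<iota>" for \<alpha>
    using graph assms that unfolding is_graph_of_def by blast
  show ?thesis
    by (rule linearI)
      (simp_all add: graph_point_def vec_eq_iff linear_add[OF l] linear_cmul[OF l])
qed

text \<open>The graph of \<open>L\<close> is linear in the fibre coordinate \<open>y\<close>, hence equal to its own fibre derivative.\<close>

lemma Dg_fibre:
  assumes u: "u \<in> D"
  shows "frechet_derivative g (at u) (0, b) = (0, horlift (fst u, b))"
proof -
  obtain \<xi> y where u1: "u = (\<xi>, y)" and xi: "\<xi> \<in> U" using u by (auto simp: D_def)
  have "((\<lambda>y. g (\<xi>, y)) has_derivative (\<lambda>b. frechet_derivative g (at u) (0, b))) (at y)"
    by (rule has_derivative_compose[of "\<lambda>y. (\<xi>, y)" "\<lambda>b. (0, b)" _ _ g, OF _ graph_has_derivative[OF u, unfolded u1], folded u1])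
      (auto intro!: derivative_eq_intros)
  moreover have "((\<lambda>y. (\<xi>, horlift (\<xi>, y))) has_derivative (\<lambda>b. (0, horlift (\<xi>, b)))) (at y)"
    by (intro has_derivative_Pair has_derivative_const linear_imp_has_derivative linear_horlift xi)
  moreover have "(\<lambda>y. g (\<xi>, y)) = (\<lambda>y. (\<xi>, horlift (\<xi>, y)))"
    by (rule ext) (simp add: prod_eq_iff)
  ultimately have "(\<lambda>b. frechet_derivative g (at u) (0, b)) = (\<lambda>b. (0, horlift (\<xi>, b)))"
    using has_derivative_unique by metis
  then show ?thesis using u1 by (metis fst_conv)
qed

lemma L_components_Dg:
  assumes u: "u \<in> D"
  shows "L_components \<iota> (frechet_derivative g (at u) v) = v"
proof -
  have "((\<lambda>u. L_components \<iota> (g u)) has_derivative (\<lambda>v. L_components \<iota> (frechet_derivative g (at u) v))) (at u)"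
    by (rule bounded_linear.has_derivative[OF bounded_linear_L_components graph_has_derivative[OF u]])
  then have "(\<lambda>v. L_components \<iota> (frechet_derivative g (at u) v)) = (\<lambda>v. v)"
    using has_derivative_unique[OF _ has_derivative_ident] by (simp add: L_components_graph_point[OF inj])
  then show ?thesis by metis
qed

lemma graph_proj_tan_eq:
  assumes u: "u \<in> D"
  shows "graph_proj_tan \<iota> l u v = frechet_derivative g (at u) (L_components \<iota> v)"
proof -
  have "((\<lambda>p. g (L_components \<iota> p)) has_derivative
      (\<lambda>v. frechet_derivative g (at u) (L_components \<iota> v))) (at (g u))"
    by (rule has_derivative_compose[OF bounded_linear_imp_has_derivative[OF bounded_linear_L_components]])
      (simp only: L_components_graph_point[OF inj] graph_has_derivative[OF u])
  moreover have "graph_proj \<iota> l = (\<lambda>p. g (L_components \<iota> p))"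
    by (auto simp: graph_proj_def L_components_def)
  ultimately show ?thesis
    unfolding graph_proj_tan_def using frechet_derivative_eqI by metis
qed

lemma delta_field_eq:
  assumes p: "p \<in> U \<times> (- {0})"
  shows "delta_field Gbc B p = (axis B 1, - frechet_derivative Gbc (at p) (0, axis B 1))"
proof -
  have d: "Gbc differentiable (at p)"
    by (rule smooth_on_imp_differentiable[OF Gbc_smooth p])
  have "pd_fibre B (\<lambda>u. Gbc u $ i) p = frechet_derivative Gbc (at p) (0, axis B 1) $ i" for i
    unfolding pd_fibre_def by (rule frechet_derivative_bounded_linear_compose[OF bounded_linear_vec_nth d])
  then show ?thesis
    unfolding delta_field_def by (simp only: vec_expand_axis[symmetric])
qed

text \<open>The fields spanning \<open>H'\<close> in the coordinates \<open>(\<xi>, y)\<close>: the horizontal lift of \<open>b\<close> paired with the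
  \<open>y\<close>-components of the horizontal field \<open>b\<^sup>i \<delta>\<^sub>x\<^sub>i\<close> of the spray of the base.\<close>

definition hfield where "hfield u b = (horlift (fst u, b), - DGc (\<kappa> u) (0, b))"

text \<open>The \<open>\<delta>\<close>-fields combine into the field with base part the horizontal lift \<open>h\<close> of the \<open>i\<close>-th unit
  vector and fibre part minus the derivative of the upper spray coefficients in the fibre direction
  \<open>h\<close>. This direction is tangent to \<open>L\<close>, where the upper coefficients project to those of the base; so
  the derivative projects to that of the base coefficients.\<close>

lemma L_components_hor_lift:
  assumes u: "u \<in> D"
  shows "L_components \<iota> (hor_lift \<iota> l Gbc u i) = hfield u (axis i 1)"
proof -
  let ?DGb = "frechet_derivative Gbc (at (g u))"
  let ?h = "horlift (fst u, axis i 1)"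
  have gu: "g u \<in> U \<times> (- {0})" by (rule graph_in_slit[OF u])
  have dGb: "(Gbc has_derivative ?DGb) (at (g u))"
    by (intro has_derivative_frechet smooth_on_imp_differentiable[OF Gbc_smooth gu])
  have lin: "linear (\<lambda>b. ?DGb (0, b))"
    by (rule linear_snd_part[OF has_derivative_linear[OF dGb]])
  have pl: "pd_fibre i (l \<alpha>) u = ?h $ \<alpha>" if "\<alpha> \<notin> range \<iota>" for \<alpha>
  proof -
    have "((\<lambda>u. snd (g u) $ \<alpha>) has_derivative (\<lambda>v. snd (frechet_derivative g (at u) v) $ \<alpha>)) (at u)"
      by (rule bounded_linear.has_derivative[OF bounded_linear_compose[OF bounded_linear_vec_nth bounded_linear_snd]
            graph_has_derivative[OF u]])
    moreover have "(\<lambda>u. snd (g u) $ \<alpha>) = l \<alpha>" using that by (auto simp: graph_point_def)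
    ultimately have "frechet_derivative (l \<alpha>) (at u) = (\<lambda>v. snd (frechet_derivative g (at u) v) $ \<alpha>)"
      by (simp add: frechet_derivative_eqI)
    then show ?thesis by (simp add: pd_fibre_def Dg_fibre[OF u])
  qed
  have hsum: "f (axis (\<iota> i) 1) + (\<Sum>\<alpha>\<in>- range \<iota>. pd_fibre i (l \<alpha>) u *\<^sub>R f (axis \<alpha> 1)) = f ?h"
    if "linear f" for f :: "real^'m \<Rightarrow> real^'m"
  proof -
    have r: "?h $ \<iota> j = axis i 1 $ j" for j by (simp add: graph_point_def inv_f_f[OF inj])
    have "f ?h = (\<Sum>B\<in>UNIV. ?h $ B *\<^sub>R f (axis B 1))" by (rule linear_sum_axis[OF that])
    also have "\<dots> = (\<Sum>B\<in>range \<iota>. ?h $ B *\<^sub>R f (axis B 1)) + (\<Sum>B\<in>- range \<iota>. ?h $ B *\<^sub>R f (axis B 1))"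
      by (subst sum.union_disjoint[symmetric]) auto
    also have "(\<Sum>B\<in>range \<iota>. ?h $ B *\<^sub>R f (axis B 1)) = (\<Sum>j\<in>UNIV. axis i 1 $ j *\<^sub>R f (axis (\<iota> j) 1))"
      by (simp add: sum.reindex[OF inj] r)
    also have "\<dots> = f (axis (\<iota> i) 1)"
      by (simp add: axis_def if_distrib[of "\<lambda>x. x *\<^sub>R _"] cong: if_cong)
    finally show ?thesis by (simp add: pl)
  qed
  have "hor_lift \<iota> l Gbc u i = (?h, - ?DGb (0, ?h))"
    unfolding hor_lift_def delta_field_eq[OF gu] prod_eq_iff
    using hsum[of "\<lambda>v. v"] hsum[OF lin]
    by (simp add: linear_id[unfolded id_def] fst_sum snd_sum sum_negf algebra_simps)
  moreover have "hor \<iota> (?DGb (0, ?h)) = DGc (\<kappa> u) (0, axis i 1)"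
  proof -
    have "((\<lambda>u. hor \<iota> (Gbc (g u))) has_derivative
        (\<lambda>v. hor \<iota> (?DGb (frechet_derivative g (at u) v)))) (at u)"
      by (intro bounded_linear.has_derivative[OF bounded_linear_hor]
          has_derivative_compose[OF graph_has_derivative[OF u] dGb])
    then have "((\<lambda>u. Gc (\<kappa> u)) has_derivative
        (\<lambda>v. hor \<iota> (?DGb (frechet_derivative g (at u) v)))) (at u)"
      by (rule has_derivative_transform_within_open[OF _ open_D u]) (rule hor_spray_coeff)
    moreover have "((\<lambda>u. Gc (\<kappa> u)) has_derivative (\<lambda>v. DGc (\<kappa> u) (\<kappa> v))) (at u)"
      by (rule has_derivative_compose[OF bounded_linear_imp_has_derivative[OF bounded_linear_\<kappa>] Gc_has_derivative[OF u]])
    ultimately have "(\<lambda>v. hor \<iota> (?DGb (frechet_derivative g (at u) v))) = (\<lambda>v. DGc (\<kappa> u) (\<kappa> v))"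
      by (rule has_derivative_unique)
    then have "hor \<iota> (?DGb (frechet_derivative g (at u) (0, axis i 1))) = DGc (\<kappa> u) (\<kappa> (0, axis i 1))"
      by metis
    then show ?thesis by (simp add: Dg_fibre[OF u] linear_simps[OF bounded_linear_hor])
  qed
  ultimately show ?thesis
    by (simp add: L_components_def hfield_def linear_simps[OF bounded_linear_hor])
qed

lemma linear_hfield:
  assumes "u \<in> D" shows "linear (hfield u)"
proof -
  have "fst u \<in> U" using assms by (auto simp: D_def)
  note l = linear_horlift[OF this] linear_snd_part[OF linear_DGc[OF assms]]
  show ?thesis
    by (rule linearI)
      (simp_all add: hfield_def linear_add[OF l(1)] linear_add[OF l(2)] linear_cmul[OF l(1)] linear_cmul[OF l(2)])
qed

lemma linear_Dg: "u \<in> D \<Longrightarrow> linear (frechet_derivative g (at u))"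
  by (rule has_derivative_linear[OF graph_has_derivative])

lemma bundle_H'_eq:
  assumes u: "u \<in> D"
  shows "bundle_H' \<iota> l Gbc u = range (\<lambda>b. frechet_derivative g (at u) (hfield u b))"
proof -
  let ?f = "\<lambda>b. frechet_derivative g (at u) (hfield u b)"
  have l: "linear ?f" by (rule linear_compose[OF linear_hfield[OF u] linear_Dg[OF u], unfolded o_def])
  have gen: "graph_proj_tan \<iota> l u (hor_lift \<iota> l Gbc u i) = ?f (axis i 1)" for i
    by (simp add: graph_proj_tan_eq[OF u] L_components_hor_lift[OF u])
  show ?thesis
    unfolding bundle_H'_def gen
  proof
    show "span (range (\<lambda>i. ?f (axis i 1))) \<subseteq> range ?f"
      by (rule span_minimal) (auto intro: linear_subspace_image[OF l subspace_UNIV])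
    show "range ?f \<subseteq> span (range (\<lambda>i. ?f (axis i 1)))"
    proof (rule image_subsetI)
      fix b show "?f b \<in> span (range (\<lambda>i. ?f (axis i 1)))"
        by (subst linear_sum_axis[OF l, of b]) (intro span_sum span_scale span_base rangeI)
    qed
  qed
qed

text \<open>In the coordinates \<open>(\<xi>, y)\<close> the spray is \<open>S = (horlift, -2G)\<close> and the section is
  \<open>Y = (horlift b, -N b)\<close> with a varying coefficient \<open>b\<close>, so the bracket is an explicit derivative.
  Write \<open>cc\<close> for the projection of its base part. Subtracting the element \<open>hfield cc\<close> of \<open>H'\<close> leaves a
  base part \<open>\<zeta>\<close> that projects to zero, which lies in \<open>K'\<close>, and a fibre part from which the derivative
  \<open>\<beta>\<close> of \<open>b\<close> along the spray cancels; what remains is the curvature \<open>R\<close>.\<close>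

theorem bracket_mod_H'_K':
  assumes u: "u \<in> D" and W: "open W" "u \<in> W" "W \<subseteq> D" and X: "smooth_on W X"
    and H: "\<And>w. w \<in> W \<Longrightarrow> X w \<in> bundle_H' \<iota> l Gbc w"
    and a: "L_components \<iota> (X u) = hfield u a"
  shows "\<exists>h\<in>bundle_H' \<iota> l Gbc u. \<exists>k\<in>bundle_K' \<iota> l u.
    bracket_on_L \<iota> l (\<lambda>u. V u) X u =
      (\<Sum>k\<in>UNIV. (\<Sum>i\<in>UNIV. a $ i * riemann_curvature Gc k i (\<kappa> u)) *\<^sub>R dy_on_L \<iota> l u k) + (h + k)"
proof -
  define S where "S w = L_components \<iota> (V w)" for w
  define Y where "Y w = L_components \<iota> (X w)" for w
  define b where "b w = hor \<iota> (fst (Y w))" for w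
  let ?N = "\<lambda>v. DGc (\<kappa> u) (0, v)"
  define E where "E v = frechet_derivative (\<lambda>p. DGc p (0, v)) (at (\<kappa> u))" for v
  have Dh: "hor \<iota> (horlift w) = snd w" for w by (rule hor_horlift)
  have S_eq: "S w = (horlift w, -2 *\<^sub>R Gc (\<kappa> w))" if "w \<in> D" for w
    unfolding S_def L_components_def V_components[OF that]
    by (simp add: linear_simps[OF bounded_linear_hor] hor_spray_coeff[OF that])
  have Y_eq: "Y w = hfield w (b w)" if w: "w \<in> W" for w
  proof -
    have "w \<in> D" using W(3) w by blast
    then obtain v where "X w = frechet_derivative g (at w) (hfield w v)"
      using H[OF w] bundle_H'_eq by blast
    then have "Y w = hfield w v" using L_components_Dg[OF \<open>w \<in> D\<close>] by (simp add: Y_def)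
    then show ?thesis by (simp add: b_def hfield_def Dh)
  qed
  have bu: "b u = a" using a by (simp add: b_def Y_def hfield_def Dh)
  obtain S' where S': "(S has_derivative S') (at u)"
    using bounded_linear.has_derivative[OF bounded_linear_L_components
        has_derivative_frechet[OF smooth_on_imp_differentiable[OF V_smooth u]]]
    unfolding S_def by blast
  obtain Y' where Y': "(Y has_derivative Y') (at u)"
    using bounded_linear.has_derivative[OF bounded_linear_L_components
        has_derivative_frechet[OF smooth_on_imp_differentiable[OF X W(2)]]]
    unfolding Y_def by blast
  have lb: "lie_bracket S Y u = Y' (S u) - S' (Y u)"
    unfolding lie_bracket_def frechet_derivative_eqI[OF S'] frechet_derivative_eqI[OF Y'] ..
  note hf = bounded_linear_compose[OF bounded_linear_hor bounded_linear_fst]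
  have S1: "hor \<iota> (fst (S' v)) = snd v" for v
  proof -
    have "((\<lambda>w. hor \<iota> (fst (S w))) has_derivative (\<lambda>v. hor \<iota> (fst (S' v)))) (at u)"
      by (rule bounded_linear.has_derivative[OF hf S'])
    then have "(snd has_derivative (\<lambda>v. hor \<iota> (fst (S' v)))) (at u)"
      by (rule has_derivative_transform_within_open[OF _ open_D u]) (simp add: S_eq Dh)
    from fun_cong[OF has_derivative_unique[OF this bounded_linear_imp_has_derivative[OF bounded_linear_snd]]]
    show ?thesis .
  qed
  have S2: "snd (S' v) = -2 *\<^sub>R DGc (\<kappa> u) (\<kappa> v)" for v
  proof -
    have "((\<lambda>w. snd (S w)) has_derivative (\<lambda>v. snd (S' v))) (at u)"
      by (rule bounded_linear.has_derivative[OF bounded_linear_snd S'])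
    then have 1: "((\<lambda>w. -2 *\<^sub>R Gc (\<kappa> w)) has_derivative (\<lambda>v. snd (S' v))) (at u)"
      by (rule has_derivative_transform_within_open[OF _ open_D u]) (simp add: S_eq)
    have "((\<lambda>w. -2 *\<^sub>R Gc (\<kappa> w)) has_derivative (\<lambda>v. -2 *\<^sub>R DGc (\<kappa> u) (\<kappa> v))) (at u)"
      by (intro has_derivative_scaleR_right
          has_derivative_compose[OF bounded_linear_imp_has_derivative[OF bounded_linear_\<kappa>] Gc_has_derivative[OF u]])
    from fun_cong[OF has_derivative_unique[OF 1 this]] show ?thesis .
  qed
  define \<beta> where "\<beta> = hor \<iota> (fst (Y' (S u)))"
  have b': "(b has_derivative (\<lambda>v. hor \<iota> (fst (Y' v)))) (at u)"
    unfolding b_def by (rule bounded_linear.has_derivative[OF hf Y'])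
  have dE: "((\<lambda>p. DGc p (0, v)) has_derivative E v) (at (\<kappa> u))" for v
    unfolding E_def
    by (intro has_derivative_frechet smooth_on_imp_differentiable[OF smooth_on_frechet_derivative[OF Gc_smooth] \<kappa>_in_base[OF u]])
  \<comment> \<open>Second derivatives of the spray coefficients enter only through \<open>E\<close>, which is linear in its fibre
    direction because \<open>DGc p\<close> is.\<close>
  have Ea: "(\<Sum>k\<in>UNIV. a $ k *\<^sub>R E (axis k 1) v) = E a v" for v
  proof -
    have "((\<lambda>p. \<Sum>k\<in>UNIV. a $ k *\<^sub>R DGc p (0, axis k 1)) has_derivative
        (\<lambda>v. \<Sum>k\<in>UNIV. a $ k *\<^sub>R E (axis k 1) v)) (at (\<kappa> u))"
      by (intro has_derivative_sum has_derivative_scaleR_right dE)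
    then have "((\<lambda>p. DGc p (0, a)) has_derivative
        (\<lambda>v. \<Sum>k\<in>UNIV. a $ k *\<^sub>R E (axis k 1) v)) (at (\<kappa> u))"
    proof (rule has_derivative_transform_within_open[OF _ open_base \<kappa>_in_base[OF u]])
      fix p :: "(real^'n) \<times> (real^'n)" assume "p \<in> snd c ` fst c \<times> - {0}"
      then have "linear (DGc p)"
        by (intro linear_frechet_derivative smooth_on_imp_differentiable[OF Gc_smooth])
      from linear_sum_axis[OF linear_snd_part[OF this], of a]
      show "(\<Sum>k\<in>UNIV. a $ k *\<^sub>R DGc p (0, axis k 1)) = DGc p (0, a)" by simp
    qed
    from fun_cong[OF has_derivative_unique[OF this dE]] show ?thesis .
  qed
  \<comment> \<open>The coefficient \<open>b\<close> varies with the point, so \<open>N b\<close> is expanded over unit vectors before the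
    product rule is applied.\<close>
  have Y2: "snd (Y' v) = - (?N (hor \<iota> (fst (Y' v))) + E a (\<kappa> v))" for v
  proof -
    have "((\<lambda>w. snd (Y w)) has_derivative (\<lambda>v. snd (Y' v))) (at u)"
      by (rule bounded_linear.has_derivative[OF bounded_linear_snd Y'])
    then have 1: "((\<lambda>w. - (\<Sum>k\<in>UNIV. b w $ k *\<^sub>R DGc (\<kappa> w) (0, axis k 1))) has_derivative
        (\<lambda>v. snd (Y' v))) (at u)"
    proof (rule has_derivative_transform_within_open[OF _ W(1,2)])
      fix w assume w: "w \<in> W"
      then have "linear (DGc (\<kappa> w))" using W(3) linear_DGc by blast
      from linear_sum_axis[OF linear_snd_part[OF this], of "b w"]
      show "snd (Y w) = - (\<Sum>k\<in>UNIV. b w $ k *\<^sub>R DGc (\<kappa> w) (0, axis k 1))"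
        by (simp add: Y_eq[OF w] hfield_def)
    qed
    have "((\<lambda>w. - (\<Sum>k\<in>UNIV. b w $ k *\<^sub>R DGc (\<kappa> w) (0, axis k 1))) has_derivative
        (\<lambda>v. - (\<Sum>k\<in>UNIV. b u $ k *\<^sub>R E (axis k 1) (\<kappa> v)
          + hor \<iota> (fst (Y' v)) $ k *\<^sub>R DGc (\<kappa> u) (0, axis k 1)))) (at u)"
      by (intro has_derivative_minus has_derivative_sum has_derivative_scaleR
          bounded_linear.has_derivative[OF bounded_linear_vec_nth b']
          has_derivative_compose[OF bounded_linear_imp_has_derivative[OF bounded_linear_\<kappa>] dE])
    from fun_cong[OF has_derivative_unique[OF 1 this]]
    have "snd (Y' v) = - (\<Sum>k\<in>UNIV. b u $ k *\<^sub>R E (axis k 1) (\<kappa> v)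
          + hor \<iota> (fst (Y' v)) $ k *\<^sub>R DGc (\<kappa> u) (0, axis k 1))" .
    then show ?thesis
      using linear_sum_axis[OF linear_snd_part[OF linear_DGc[OF u]], of "hor \<iota> (fst (Y' v))"]
      by (simp add: sum.distrib bu Ea)
  qed
  define B where "B = lie_bracket S Y u"
  define cc where "cc = hor \<iota> (fst B)"
  \<comment> \<open>This is the curvature applied to \<open>a\<close>, by \<open>riemann_curvature_contract\<close>.\<close>
  define R where "R = 2 *\<^sub>R DGc (\<kappa> u) (a, 0) - E a (snd u, -2 *\<^sub>R Gc (\<kappa> u)) - ?N (?N a)"
  have lN: "linear ?N" by (rule linear_snd_part[OF linear_DGc[OF u]])
  have Yu: "Y u = (horlift (fst u, a), - ?N a)" using a by (simp add: Y_def hfield_def)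
  have cc: "cc = \<beta> + ?N a"
    by (simp add: cc_def B_def lb linear_simps[OF bounded_linear_hor] S1 \<beta>_def Yu)
  have kS: "\<kappa> (S u) = (snd u, -2 *\<^sub>R Gc (\<kappa> u))" by (simp add: S_eq[OF u] Dh)
  have kY: "\<kappa> (Y u) = (a, - ?N a)" by (simp add: Yu Dh)
  have "snd B = - (?N \<beta> + E a (\<kappa> (S u))) + 2 *\<^sub>R DGc (\<kappa> u) (\<kappa> (Y u))"
    by (simp add: B_def lb Y2 S2 \<beta>_def)
  also have "DGc (\<kappa> u) (\<kappa> (Y u)) = DGc (\<kappa> u) (a, 0) - ?N (?N a)"
    unfolding kY using linear_Pair_split[OF linear_DGc[OF u], of a "- ?N a"]
    by (simp add: linear_neg[OF lN])
  finally have B2: "snd B = R - ?N cc"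
    unfolding kS by (simp add: R_def cc linear_add[OF lN] algebra_simps scaleR_2)
  define \<zeta> where "\<zeta> = fst B - horlift (fst u, cc)"
  have B: "B = (0, R) + (hfield u cc + (\<zeta>, 0))"
    by (simp add: prod_eq_iff B2 hfield_def \<zeta>_def)
  have Rk: "(\<Sum>i\<in>UNIV. a $ i * riemann_curvature Gc k i (\<kappa> u)) = R $ k" for k
    using riemann_curvature_contract[OF open_base Gc_smooth \<kappa>_in_base[OF u], of a k]
    by (simp add: R_def E_def)
  let ?Dg = "frechet_derivative g (at u)"
  have br: "bracket_on_L \<iota> l (\<lambda>u. V u) X u = ?Dg B"
    unfolding bracket_on_L_def B_def S_def Y_def ..
  also have "\<dots> = ?Dg (0, R) + (?Dg (hfield u cc) + ?Dg (\<zeta>, 0))"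
    unfolding B by (simp only: linear_add[OF linear_Dg[OF u]])
  also have "?Dg (0, R) = (\<Sum>k\<in>UNIV. R $ k *\<^sub>R dy_on_L \<iota> l u k)"
  proof -
    have "dy_on_L \<iota> l u k = ?Dg (0, axis k 1)" for k
    proof -
      have "hor \<iota> (axis (\<iota> k) 1) = axis k 1"
        using inj by (auto simp: hor_def axis_def vec_eq_iff inj_eq)
      then show ?thesis by (simp add: dy_on_L_def graph_proj_tan_eq[OF u] L_components_def)
    qed
    then show ?thesis by (simp add: linear_sum_axis[OF linear_snd_part[OF linear_Dg[OF u]], of R])
  qed
  finally have fin: "bracket_on_L \<iota> l (\<lambda>u. V u) X u =
      (\<Sum>k\<in>UNIV. (\<Sum>i\<in>UNIV. a $ i * riemann_curvature Gc k i (\<kappa> u)) *\<^sub>R dy_on_L \<iota> l u k)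
      + (?Dg (hfield u cc) + ?Dg (\<zeta>, 0))" by (simp only: Rk)
  have "?Dg (hfield u cc) \<in> bundle_H' \<iota> l Gbc u" using bundle_H'_eq[OF u] by blast
  moreover have "?Dg (\<zeta>, 0) \<in> bundle_K' \<iota> l u"
    using L_components_Dg[OF u, of "(\<zeta>, 0)"]
    by (simp add: bundle_K'_def tangent_L_def bundle_K_def L_components_def \<zeta>_def
        linear_simps[OF bounded_linear_hor] Dh cc_def)
  ultimately show ?thesis using fin by blast
qed

end

theorem lemma3p7:
  fixes Ab :: "('p::{t2_space, second_countable_topology}, real^'m) chart set"
    and A :: "('q::{t2_space, second_countable_topology}, real^'n) chart set"
    and Gb :: "('p, real^'m) bundle_field" and G :: "('q, real^'n) bundle_field"
    and \<pi> :: "'p \<Rightarrow> 'q" and L :: "'p \<Rightarrow> ('p, real^'m) tvec set"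
    and \<iota> :: "'n::finite \<Rightarrow> 'm::finite"
    and cb :: "('p, real^'m) chart" and c :: "('q, real^'n) chart"
    and l :: "'m \<Rightarrow> (real^'m) \<times> (real^'n) \<Rightarrow> real"
    and \<xi> :: "real^'m" and y :: "real^'n" and a :: "'n \<Rightarrow> real"
    and W :: "((real^'m) \<times> (real^'n)) set"
    and X :: "(real^'m) \<times> (real^'n) \<Rightarrow> (real^'m) \<times> (real^'m)"
  assumes "smooth_structure Ab" and "smooth_structure A"
    and "spray_submersion Ab Gb A G \<pi> L"
    and "inj \<iota>" and "cb \<in> Ab" and "c \<in> A" and "adapted_charts \<iota> \<pi> cb c"
    and "is_graph_of \<iota> Ab cb L l"
    and "\<xi> \<in> snd cb ` fst cb" and "y \<noteq> 0"
    and "open W" and "(\<xi>, y) \<in> W" and "W \<subseteq> (snd cb ` fst cb) \<times> (- {0})"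
    and "smooth_on W X"
    and "\<forall>u\<in>W. X u \<in> bundle_H' \<iota> l (spray_coeff Ab Gb cb) u"
    and "X (\<xi>, y) = graph_proj_tan \<iota> l (\<xi>, y)
           (\<Sum>i\<in>UNIV. a i *\<^sub>R hor_lift \<iota> l (spray_coeff Ab Gb cb) (\<xi>, y) i)"
  shows "\<exists>h\<in>bundle_H' \<iota> l (spray_coeff Ab Gb cb) (\<xi>, y). \<exists>k\<in>bundle_K' \<iota> l (\<xi>, y).
      bracket_on_L \<iota> l (\<lambda>u. local_rep (slit_chart Ab cb) Gb (graph_point \<iota> l u)) X (\<xi>, y) =
      (\<Sum>i\<in>UNIV. \<Sum>k\<in>UNIV.
         (a i * riemann_curvature (spray_coeff A G c) k i (hor \<iota> \<xi>, y)) *\<^sub>R dy_on_L \<iota> l (\<xi>, y) k)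
      + (h + k)"
proof -
  interpret submersion_coordinates Ab A Gb G \<pi> L \<iota> cb c l
    by unfold_locales (use assms smooth_structure_imp_smooth_atlas in auto)
  let ?u = "(\<xi>, y)"
  have u: "?u \<in> D" using assms by (simp add: D_def)
  have W: "W \<subseteq> D" using assms by (simp add: D_def)
  have "L_components \<iota> (X ?u) = (\<Sum>i\<in>UNIV. a i *\<^sub>R hfield ?u (axis i 1))"
    unfolding assms(16) graph_proj_tan_eq[OF u] L_components_Dg[OF u]
    by (simp add: linear_simps[OF bounded_linear_L_components] L_components_hor_lift[OF u]
        linear_sum[OF bounded_linear.linear[OF bounded_linear_L_components]])
  also have "\<dots> = hfield ?u (\<chi> i. a i)"
    using linear_sum_axis[OF linear_hfield[OF u], of "\<chi> i. a i"] by simp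
  finally have Xa: "L_components \<iota> (X ?u) = hfield ?u (\<chi> i. a i)" .
  have sw: "(\<Sum>k\<in>UNIV. (\<Sum>i\<in>UNIV. (\<chi> i. a i) $ i * r k i) *\<^sub>R d k) = (\<Sum>i\<in>UNIV. \<Sum>k\<in>UNIV. (a i * r k i) *\<^sub>R d k)"
    for r :: "'n \<Rightarrow> 'n \<Rightarrow> real" and d :: "'n \<Rightarrow> (real^'m) \<times> (real^'m)"
    by (subst sum.swap) (simp add: scaleR_sum_left)
  show ?thesis
    using bracket_mod_H'_K'[OF u assms(11,12) W assms(14) _ Xa] assms(15)
    unfolding sw fst_conv snd_conv by blast
qed

end
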